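(* Let $X$ be a compact, locally connected metric space. Then the first singular homology group $H_1(X)$ (with integer coefficients) is either uncountable or isomorphic to a direct sum of finitely many cyclic groups. *)

theory Defs
  imports "HOL-Analysis.Analysis" "HOL-Algebra.Free_Abelian_Groups"
          "HOL-Algebra.Product_Groups" "HOL-Algebra.Elementary_Groups"
begin

type_synonym 'a chain = "((nat \<Rightarrow> real) \<Rightarrow> 'a) \<Rightarrow>\<^sub>0 int"

definition standard_simplex :: "nat \<Rightarrow> (nat \<Rightarrow> real) set" where
  "standard_simplex p \<equiv>
    {x. (\<forall>i. 0 \<le> x i \<and> x i \<le> 1) \<and> (\<forall>i>p. x i = 0) \<and> (\<Sum>i\<le>p. x i) = 1}"

definition simplical_face :: "nat \<Rightarrow> (nat \<Rightarrow> 'a) \<Rightarrow> nat \<Rightarrow> 'a::comm_monoid_add" where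
   "simplical_face k x \<equiv> \<lambda>i. if i < k then x i else if i = k then 0 else x(i -1)"

definition singular_simplex :: "nat \<Rightarrow> 'a topology \<Rightarrow> ((nat \<Rightarrow> real) \<Rightarrow> 'a) \<Rightarrow> bool" where
 "singular_simplex p X f \<equiv>
      continuous_map(subtopology (powertop_real UNIV) (standard_simplex p)) X f
    \<and> f \<in> extensional (standard_simplex p)"

definition singular_face :: "nat \<Rightarrow> nat \<Rightarrow> ((nat \<Rightarrow> real) \<Rightarrow> 'a) \<Rightarrow> (nat \<Rightarrow> real) \<Rightarrow> 'a"
  where "singular_face p k f \<equiv> restrict (f \<circ> simplical_face k) (standard_simplex (p - Suc 0))"

definition singular_chain :: "[nat, 'a topology, 'a chain] \<Rightarrow> bool"
  where "singular_chain p X c \<equiv> Poly_Mapping.keys c \<subseteq> Collect (singular_simplex p X)"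

definition chain_boundary :: "nat \<Rightarrow> ('a chain) \<Rightarrow> 'a chain"
  where "chain_boundary p c \<equiv>
          (if p = 0 then 0 else
           frag_extend (\<lambda>f. (\<Sum>k\<le>p. frag_cmul ((-1) ^ k) (frag_of(singular_face p k f)))) c)"

definition singular_cycle :: "nat \<Rightarrow> 'a topology \<Rightarrow> 'a chain \<Rightarrow> bool"
  where "singular_cycle p X c \<equiv> singular_chain p X c \<and> chain_boundary p c = 0"

definition singular_boundary :: "nat \<Rightarrow> 'a topology \<Rightarrow> 'a chain \<Rightarrow> bool"
  where "singular_boundary p X c \<equiv>
           \<exists>d. singular_chain (Suc p) X d \<and> chain_boundary (Suc p) d = c"

definition chain_group :: "nat \<Rightarrow> 'a topology \<Rightarrow> 'a chain monoid"
  where "chain_group p X \<equiv> free_Abelian_group (Collect (singular_simplex p X))"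

definition cycle_group :: "nat \<Rightarrow> 'a topology \<Rightarrow> 'a chain monoid"
  where "cycle_group p X \<equiv> subgroup_generated (chain_group p X) (Collect (singular_cycle p X))"

definition singular_homology_group :: "nat \<Rightarrow> 'a topology \<Rightarrow> 'a chain set monoid"
  where "singular_homology_group p X \<equiv> cycle_group p X Mod Collect (singular_boundary p X)"

end

theory Submission
  imports Defs "HOL-Homology.Homology_Groups" "HOL-Probability.Infinite_Product_Measure"
begin

text \<open>
  A compact locally connected metric space is uniformly locally path connected. If for some
  \<open>\<epsilon>\<close> every loop in an \<open>\<epsilon>\<close>-ball bounds, then every path is homologous, up to correction terms that
  depend only on its end points, to a chain of standard arcs between points of a finite net; so
  the cycles are generated, modulo boundaries, by a subgroup of a finitely generated free abelian
  group, and \<open>H\<^sub>1\<close> is a finite direct sum of cyclic groups.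

  Otherwise there are a point \<open>x\<close> and non-bounding loops \<open>l\<^sub>n\<close> at \<open>x\<close> shrinking to \<open>x\<close>. For
  \<open>\<alpha> \<in> 2\<^sup>\<nat>\<close> let \<open>L\<^sub>\<alpha>\<close> be the infinite concatenation of the \<open>l\<^sub>n\<close> with \<open>\<alpha> n\<close>. Changing a single
  coordinate of \<open>\<alpha>\<close> changes the class of \<open>L\<^sub>\<alpha>\<close>. If \<open>H\<^sub>1\<close> were countable, then for some class and some
  list of coefficients the set of those \<open>\<alpha>\<close> for which \<open>L\<^sub>\<alpha>\<close> is in this class, witnessed by a
  2-chain with these coefficients, has positive outer measure for the coin tossing measure.
  Prescribing moduli of continuity for the 2-simplices writes this set as a union of closed sets,
  and continuity of outer measures along increasing unions yields a closed subset of positive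
  measure. Such a set contains two points that differ in exactly one coordinate: a contradiction.
\<close>

section \<open>Finitely generated subgroups of free abelian groups\<close>

text \<open>The parameters \<open>\<alpha>\<close> whose loop lies in a given class form a
  projection along all 2-chains and have no evident measurability; this forces outer measures and a
  capacitability argument. Fixing the coefficients and the moduli of continuity confines the
  2-chains to a compact set of tuples of simplices, and projecting along a compact factor preserves
  closedness. The coefficient lists are countably many, and the moduli are released one at a time by
  increasing unions, which outer measure tolerates. Changes of a single coordinate are the right
  ones to look for: the two loops then differ on one interval only, so a finite subdivision compares
  them. In the finitely generated case the standard arcs are not cycles. They span a group of chains
  that has to be cut down to the cycles and then presented modulo the boundaries, which is the task
  of the algebra below.\<close>

definition add_subgroup :: "'a::ab_group_add set \<Rightarrow> bool" where
  "add_subgroup B \<longleftrightarrow> 0 \<in> B \<and> (\<forall>a\<in>B. \<forall>b\<in>B. a - b \<in> B)"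

lemma add_subgroup_0: "add_subgroup B \<Longrightarrow> 0 \<in> B"
  and add_subgroup_diff: "add_subgroup B \<Longrightarrow> a \<in> B \<Longrightarrow> b \<in> B \<Longrightarrow> a - b \<in> B"
  by (auto simp: add_subgroup_def)

lemma add_subgroup_minus: "add_subgroup B \<Longrightarrow> a \<in> B \<Longrightarrow> - a \<in> B"
  using add_subgroup_diff[of B 0 a] add_subgroup_0 by auto

lemma add_subgroup_add: "add_subgroup B \<Longrightarrow> a \<in> B \<Longrightarrow> b \<in> B \<Longrightarrow> a + b \<in> B"
  using add_subgroup_diff[of B a "- b"] add_subgroup_minus by fastforce

lemma add_subgroup_sum: "add_subgroup B \<Longrightarrow> (\<And>i. i \<in> I \<Longrightarrow> f i \<in> B) \<Longrightarrow> sum f I \<in> B"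
  by (induction I rule: infinite_finite_induct) (auto simp: add_subgroup_0 add_subgroup_add)

lemma add_subgroup_cmul:
  assumes "add_subgroup B" "a \<in> B" shows "frag_cmul k a \<in> B"
proof (induction k rule: int_induct[where k=0])
  case base then show ?case using assms by (simp add: add_subgroup_0)
next
  case (step1 i) then show ?case using assms by (simp add: frag_cmul_distrib add_subgroup_add)
next
  case (step2 i) then show ?case using assms by (simp add: frag_cmul_diff_distrib add_subgroup_diff)
qed

definition comb :: "'i set \<Rightarrow> ('i \<Rightarrow> int) \<Rightarrow> ('i \<Rightarrow> 'k \<Rightarrow>\<^sub>0 int) \<Rightarrow> 'k \<Rightarrow>\<^sub>0 int" where
  "comb I c x = (\<Sum>i\<in>I. frag_cmul (c i) (x i))"

text \<open>Generators are an indexed family without any independence: zero or redundant members are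
  allowed, so a generator can be replaced at its index while the index set, and with it the number
  of cyclic factors, stays fixed.\<close>

definition lspan :: "'i set \<Rightarrow> ('i \<Rightarrow> 'k \<Rightarrow>\<^sub>0 int) \<Rightarrow> ('k \<Rightarrow>\<^sub>0 int) set" where
  "lspan I x = range (\<lambda>c. comb I c x)"

lemma comb_in_lspan: "comb I c x \<in> lspan I x"
  unfolding lspan_def by (rule rangeI)

lemma lspanE:
  assumes "v \<in> lspan I x" obtains c where "v = comb I c x"
  using assms unfolding lspan_def by auto

lemma comb_cong: "(\<And>i. i \<in> I \<Longrightarrow> c i = d i) \<Longrightarrow> (\<And>i. i \<in> I \<Longrightarrow> x i = y i) \<Longrightarrow> comb I c x = comb I d y"
  unfolding comb_def by (auto intro: sum.cong)

lemma comb_remove: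
  "finite I \<Longrightarrow> i \<in> I \<Longrightarrow> comb I c x = frag_cmul (c i) (x i) + comb (I - {i}) c x"
  unfolding comb_def by (simp add: sum.remove)

lemma frag_cmul_sum_right: "frag_cmul a (sum f I) = (\<Sum>i\<in>I. frag_cmul a (f i))"
  by (induction I rule: infinite_finite_induct) (auto simp: frag_cmul_distrib2)

lemma comb_diff: "comb I c x - comb I d x = comb I (\<lambda>i. c i - d i) x"
  unfolding comb_def by (simp add: frag_cmul_diff_distrib sum_subtractf)

lemma comb_add: "comb I c x + comb I d x = comb I (\<lambda>i. c i + d i) x"
  unfolding comb_def by (simp add: frag_cmul_distrib sum.distrib)

lemma comb_cmul: "frag_cmul a (comb I c x) = comb I (\<lambda>i. a * c i) x"
  unfolding comb_def by (simp add: frag_cmul_sum_right)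

lemma comb_zero: "comb I (\<lambda>i. 0) x = 0"
  unfolding comb_def by simp

lemma add_subgroup_lspan: "add_subgroup (lspan I x)"
  unfolding add_subgroup_def lspan_def using comb_zero[of I x, symmetric] by (auto simp: comb_diff)

lemma lspan_cong: "(\<And>i. i \<in> I \<Longrightarrow> x i = y i) \<Longrightarrow> lspan I x = lspan I y"
  unfolding lspan_def by (auto cong: comb_cong)

lemma lspan_remove:
  assumes "finite I" "i \<in> I"
  shows "lspan I x = {frag_cmul a (x i) + s | a s. s \<in> lspan (I - {i}) x}"
proof (intro equalityI subsetI)
  fix v assume "v \<in> lspan I x"
  then obtain c where "v = comb I c x" unfolding lspan_def by auto
  then show "v \<in> {frag_cmul a (x i) + s | a s. s \<in> lspan (I - {i}) x}"
    using comb_remove[OF assms, of c x] unfolding lspan_def by auto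
next
  fix v assume "v \<in> {frag_cmul a (x i) + s | a s. s \<in> lspan (I - {i}) x}"
  then obtain a c where v: "v = frag_cmul a (x i) + comb (I - {i}) c x"
    unfolding lspan_def by auto
  have "comb (I - {i}) (c(i := a)) x = comb (I - {i}) c x" by (rule comb_cong) auto
  then have "v = comb I (c(i := a)) x"
    using comb_remove[OF assms, of "c(i := a)" x] v by simp
  then show "v \<in> lspan I x" unfolding lspan_def by auto
qed

lemma lspan_update:
  assumes I: "finite I" "i \<in> I" and t: "t \<in> lspan (I - {i}) y"
  shows "lspan I (y(i := y i + t)) = lspan I y"
proof -
  let ?L = "lspan (I - {i}) y"
  have eq: "lspan (I - {i}) (y(i := y i + t)) = ?L" by (rule lspan_cong) auto
  note sg = add_subgroup_lspan[of "I - {i}" y]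
  have "\<exists>b s'. frag_cmul a (y i + t) + s = frag_cmul b (y i) + s' \<and> s' \<in> ?L" if "s \<in> ?L" for a s
    using add_subgroup_add[OF sg add_subgroup_cmul[OF sg t, of a] that]
    by (intro exI[of _ a] exI[of _ "frag_cmul a t + s"]) (simp add: frag_cmul_distrib2 add.assoc)
  moreover have "\<exists>b s'. frag_cmul a (y i) + s = frag_cmul b (y i + t) + s' \<and> s' \<in> ?L" if "s \<in> ?L" for a s
    using add_subgroup_diff[OF sg that add_subgroup_cmul[OF sg t, of a]]
    by (intro exI[of _ a] exI[of _ "s - frag_cmul a t"]) (simp add: frag_cmul_distrib2)
  ultimately show ?thesis
    unfolding lspan_remove[OF I] eq fun_upd_same by (intro equalityI subsetI; clarify) simp_all
qed

text \<open>The pivot is a smallest positive coefficient \<open>k\<close> occurring in any relation modulo \<open>B\<close> between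
  generators of the same span: by minimality \<open>k\<close> divides the other coefficients of its relation, so
  that this relation becomes \<open>k w \<in> B\<close> for a new generator \<open>w\<close>, and \<open>k\<close> divides the coefficient of \<open>w\<close>
  in every other relation. If there is no relation at all, the moduli are \<open>0\<close>.\<close>

lemma adapted_generators:
  assumes "finite I" and B: "add_subgroup B"
  shows "\<exists>y (m :: 'i \<Rightarrow> nat). lspan I y = lspan I x \<and>
           (\<forall>c. comb I c y \<in> B \<longleftrightarrow> (\<forall>i\<in>I. int (m i) dvd c i))"
  using assms(1)
proof (induction "card I" arbitrary: I x rule: less_induct)
  case less
  note fin = \<open>finite I\<close>
  define P where "P k \<longleftrightarrow> 0 < k \<and> (\<exists>y c i. lspan I y = lspan I x \<and> comb I c y \<in> B \<and> i \<in> I \<and> c i = int k)" for k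
  show ?case
  proof (cases "\<exists>k. P k")
    case False
    have "comb I c x \<in> B \<longleftrightarrow> (\<forall>i\<in>I. int 0 dvd c i)" for c
    proof
      assume c: "comb I c x \<in> B"
      show "\<forall>i\<in>I. int 0 dvd c i"
      proof (rule ccontr)
        assume "\<not> ?thesis"
        then obtain i where i: "i \<in> I" "c i \<noteq> 0" by auto
        have "frag_cmul (sgn (c i)) (comb I c x) \<in> B" using add_subgroup_cmul[OF B c] .
        moreover have "sgn (c i) * c i = int (nat \<bar>c i\<bar>)" by (simp add: sgn_if)
        ultimately have "P (nat \<bar>c i\<bar>)"
          unfolding P_def comb_cmul using i
          by (intro conjI exI[of _ x] exI[of _ "\<lambda>j. sgn (c i) * c j"] exI[of _ i])
             auto
        then show False using False by blast
      qed
    next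
      assume "\<forall>i\<in>I. int 0 dvd c i"
      then have "comb I c x = comb I (\<lambda>i. 0) x" by (intro comb_cong) auto
      then show "comb I c x \<in> B" using B by (simp add: comb_zero add_subgroup_0)
    qed
    then show ?thesis by (intro exI[of _ x] exI[of _ "\<lambda>_. 0"]) auto
  next
    case True
    define k where "k = (LEAST k. P k)"
    have "P k" unfolding k_def using True by (rule LeastI_ex)
    have least: "k \<le> k'" if "P k'" for k' using that unfolding k_def by (rule Least_le)
    from \<open>P k\<close> obtain y c i where k: "0 < k" and y: "lspan I y = lspan I x" and c: "comb I c y \<in> B"
      and i: "i \<in> I" and ci: "c i = int k" unfolding P_def by blast
    have dvd: "int k dvd c j" if j: "j \<in> I - {i}" for j
    proof (rule ccontr)
      assume "\<not> int k dvd c j"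
      define r where "r = c j mod int k"
      define q where "q = c j div int k"
      have cj: "c j = int k * q + r" unfolding q_def r_def by simp
      have "r \<noteq> 0" using \<open>\<not> int k dvd c j\<close> unfolding r_def dvd_eq_mod_eq_0 .
      moreover have "0 \<le> r" "r < int k" using k unfolding r_def by simp_all
      ultimately have r: "0 < r" "r < int k" by simp_all
      \<comment> \<open>A step of the Euclidean algorithm: \<open>k y\<^sub>i + (k q + r) y\<^sub>j
        = k (y\<^sub>i + q y\<^sub>j) + r y\<^sub>j\<close>. The element is the same, but its
        coefficient at \<open>j\<close> is now a positive number below the minimal
        \<open>k\<close>.\<close>
      define y' where "y' = y(i := y i + frag_cmul q (y j))"
      have tq: "frag_cmul q (y j) \<in> lspan (I - {i}) y"
      proof -
        have "lspan (I - {i}) y = {frag_cmul a (y j) + s | a s. s \<in> lspan (I - {i} - {j}) y}"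
          by (rule lspan_remove) (use fin j in auto)
        then show ?thesis using add_subgroup_0[OF add_subgroup_lspan] by force
      qed
      have sp: "lspan I y' = lspan I x" unfolding y'_def by (rule trans[OF lspan_update[OF fin i tq] y])
      have "comb I (c(j := r)) y' = comb I c y"
      proof -
        have "comb I (c(j := r)) y' = frag_cmul (int k) (y i + frag_cmul q (y j))
            + (frag_cmul r (y j) + comb (I - {i} - {j}) c y)"
        proof -
          have "comb I (c(j := r)) y' = frag_cmul ((c(j := r)) i) (y' i)
              + (frag_cmul ((c(j := r)) j) (y' j) + comb (I - {i} - {j}) (c(j := r)) y')"
            using comb_remove[OF fin i] comb_remove[OF _ j] fin by (metis finite_Diff)
          moreover have "comb (I - {i} - {j}) (c(j := r)) y' = comb (I - {i} - {j}) c y"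
            unfolding y'_def by (rule comb_cong) auto
          ultimately show ?thesis using j ci by (auto simp: y'_def)
        qed
        also have "\<dots> = frag_cmul (int k) (y i) + (frag_cmul (int k * q + r) (y j) + comb (I - {i} - {j}) c y)"
          by (simp add: frag_cmul_distrib frag_cmul_distrib2 algebra_simps)
        also have "\<dots> = comb I c y"
          using comb_remove[OF fin i, of c y] comb_remove[OF _ j, of c y] fin ci cj by simp
        finally show ?thesis .
      qed
      then have "P (nat r)" unfolding P_def using c sp r j
        by (intro conjI exI[of _ y'] exI[of _ "c(j := r)"] exI[of _ j]) auto
      then show False using least[of "nat r"] r by auto
    qed
    define t where "t = comb (I - {i}) (\<lambda>j. c j div int k) y"
    define w where "w = y i + t"
    have t: "t \<in> lspan (I - {i}) y" unfolding t_def lspan_def by auto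
    have kw: "frag_cmul (int k) w = comb I c y"
    proof -
      have "frag_cmul (int k) t = comb (I - {i}) c y"
        unfolding t_def comb_cmul using dvd by (intro comb_cong) auto
      then show ?thesis using comb_remove[OF fin i, of c y] ci by (simp add: w_def frag_cmul_distrib2)
    qed
    have spw: "lspan I (y(i := w)) = lspan I x"
      unfolding w_def by (rule trans[OF lspan_update[OF fin i t] y])
    have "card (I - {i}) < card I" by (rule psubset_card_mono[OF fin]) (use i in auto)
    from less.hyps[OF this finite_Diff[OF fin], of y] obtain z m where z: "lspan (I - {i}) z = lspan (I - {i}) y"
      and m: "\<And>c. comb (I - {i}) c z \<in> B \<longleftrightarrow> (\<forall>j\<in>I - {i}. int (m j) dvd c j)" by blast
    have cut: "comb (I - {i}) (b(i := a)) (v(i := w)) = comb (I - {i}) b v"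
      "comb (I - {i}) b (v(i := w)) = comb (I - {i}) b v"
      "comb (I - {i}) (b(i := a)) v = comb (I - {i}) b v" for a b v
      by (intro comb_cong; simp)+
    have span: "lspan I (z(i := w)) = lspan I (y(i := w))"
      using z unfolding lspan_remove[OF fin i] by (simp add: lspan_def cut del: fun_upd_apply) simp
    have rel: "comb I b (z(i := w)) \<in> B \<longleftrightarrow> (\<forall>j\<in>I. int ((m(i := k)) j) dvd b j)" for b
    proof -
      have dec: "comb I b (z(i := w)) = frag_cmul (b i) w + comb (I - {i}) b z"
        using comb_remove[OF fin i, of b "z(i := w)"] unfolding cut by simp
      have multiple: "frag_cmul (b i) w \<in> B" if "int k dvd b i"
      proof -
        from that obtain q where "b i = int k * q" by (rule dvdE)
        then have "frag_cmul (b i) w = frag_cmul q (comb I c y)" by (simp flip: kw add: mult.commute)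
        then show ?thesis using add_subgroup_cmul[OF B c] by simp
      qed
      have first: "int k dvd b i" if asm: "comb I b (z(i := w)) \<in> B"
      proof (rule ccontr)
        assume nd: "\<not> int k dvd b i"
        have "comb (I - {i}) b z \<in> lspan (I - {i}) y" using comb_in_lspan z by metis
        then obtain b' where b': "comb (I - {i}) b z = comb (I - {i}) b' y" by (rule lspanE)
        \<comment> \<open>Removing a multiple of \<open>k w\<close>, which lies in \<open>B\<close>,
          leaves a relation with coefficient \<open>r\<close> at \<open>w\<close>; a nonzero
          \<open>r\<close> would undercut the minimal \<open>k\<close>.\<close>
        define r where "r = b i mod int k"
        have "r \<noteq> 0" using nd unfolding r_def dvd_eq_mod_eq_0 .
        moreover have "0 \<le> r" "r < int k" using k unfolding r_def by simp_all
        ultimately have r: "0 < r" "r < int k" by simp_all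
        have "comb I (b'(i := r)) (y(i := w)) = frag_cmul r w + comb (I - {i}) b' y"
          using comb_remove[OF fin i, of "b'(i := r)" "y(i := w)"] unfolding cut by simp
        also have "\<dots> = comb I b (z(i := w)) - frag_cmul (b i div int k) (frag_cmul (int k) w)"
        proof -
          have "frag_cmul (b i) w = frag_cmul (b i div int k) (frag_cmul (int k) w) + frag_cmul r w"
            unfolding frag_cmul_cmul frag_cmul_distrib[symmetric] r_def by simp
          then show ?thesis unfolding dec b' by simp
        qed
        also have "\<dots> \<in> B" unfolding kw by (intro add_subgroup_diff[OF B] add_subgroup_cmul[OF B] asm c)
        finally have "P (nat r)" unfolding P_def using spw r i
          by (intro conjI exI[of _ "y(i := w)"] exI[of _ "b'(i := r)"] exI[of _ i]) auto
        then show False using least[of "nat r"] r by auto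
      qed
      have "comb (I - {i}) b z = comb I b (z(i := w)) - frag_cmul (b i) w" unfolding dec by simp
      then have "comb I b (z(i := w)) \<in> B \<longleftrightarrow> int k dvd b i \<and> comb (I - {i}) b z \<in> B"
        using first multiple add_subgroup_add[OF B] add_subgroup_diff[OF B] dec by metis
      also have "\<dots> \<longleftrightarrow> (\<forall>j\<in>I. int ((m(i := k)) j) dvd b j)" unfolding m using i by auto
      finally show ?thesis .
    qed
    show ?thesis using trans[OF span spw] rel by blast
  qed
qed

text \<open>The coefficients at \<open>x i\<close> that occur in elements of \<open>M\<close> form a
  subgroup of the integers, even though an element may have several such coefficients. An element
  \<open>w\<close> with the least positive one, together with generators of the part of
  \<open>M\<close> inside the span of the remaining \<open>x j\<close>, generates \<open>M\<close>;
  if no positive one occurs, \<open>0\<close> fills the place of \<open>w\<close>.\<close>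

lemma subgroup_of_lspan:
  assumes "finite I" and "add_subgroup M" and "M \<subseteq> lspan I x"
  shows "\<exists>y. lspan I y = M"
  using assms
proof (induction I arbitrary: M rule: finite_induct)
  case empty
  then show ?case using add_subgroup_0[of M] by (auto simp: lspan_def comb_def)
next
  case (insert i J)
  note M = \<open>add_subgroup M\<close>
  let ?L = "lspan J x"
  have J: "insert i J - {i} = J" using insert by auto
  have rem: "lspan (insert i J) y = {frag_cmul a (y i) + s | a s. s \<in> lspan J y}" for y :: "'a \<Rightarrow> 'b \<Rightarrow>\<^sub>0 int"
    using lspan_remove[of "insert i J" i y] insert J by simp
  note L = add_subgroup_lspan[of J x]
  define M' where "M' = M \<inter> ?L"
  have M': "add_subgroup M'" using M L unfolding M'_def add_subgroup_def by auto
  from insert.IH[OF M'] obtain y where y: "lspan J y = M'" unfolding M'_def by auto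
  define P where "P k \<longleftrightarrow> 0 < k \<and> (\<exists>s\<in>?L. frag_cmul (int k) (x i) + s \<in> M)" for k
  have upd: "lspan (insert i J) (y(i := w)) = {frag_cmul a w + s | a s. s \<in> M'}" for w
  proof -
    have "lspan J (y(i := w)) = lspan J y" using insert by (intro lspan_cong) auto
    then show ?thesis unfolding rem y by simp
  qed
  have pos: "P (nat \<bar>a\<bar>)" if "a \<noteq> 0" "s \<in> ?L" "frag_cmul a (x i) + s \<in> M" for a s
  proof -
    have "frag_cmul (sgn a) (frag_cmul a (x i) + s) \<in> M" using add_subgroup_cmul[OF M] that by auto
    moreover have "sgn a * a = int (nat \<bar>a\<bar>)" by (simp add: sgn_if)
    ultimately have "frag_cmul (int (nat \<bar>a\<bar>)) (x i) + frag_cmul (sgn a) s \<in> M"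
      by (simp add: frag_cmul_distrib2)
    then show ?thesis unfolding P_def using add_subgroup_cmul[OF L] that by auto
  qed
  show ?case
  proof (cases "\<exists>k. P k")
    case False
    have "M \<subseteq> ?L"
    proof
      fix v assume v: "v \<in> M"
      then obtain a s where as: "v = frag_cmul a (x i) + s" "s \<in> ?L" using insert.prems rem by auto
      then have "a = 0" using pos v False by blast
      then show "v \<in> ?L" using as by simp
    qed
    then have "M' = M" unfolding M'_def by auto
    then show ?thesis using upd[of 0] by (intro exI[of _ "y(i := 0)"]) (simp del: fun_upd_apply)
  next
    case True
    define k where "k = (LEAST k. P k)"
    have "P k" unfolding k_def using True by (rule LeastI_ex)
    have least: "k \<le> k'" if "P k'" for k' using that unfolding k_def by (rule Least_le)
    from \<open>P k\<close> obtain s0 where k: "0 < k" and s0: "s0 \<in> ?L" and wM: "frag_cmul (int k) (x i) + s0 \<in> M"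
      unfolding P_def by blast
    define w where "w = frag_cmul (int k) (x i) + s0"
    have "M \<subseteq> {frag_cmul a w + s | a s. s \<in> M'}"
    proof
      fix v assume v: "v \<in> M"
      then obtain a s where as: "v = frag_cmul a (x i) + s" "s \<in> ?L" using insert.prems rem by auto
      define q where "q = a div int k"
      define r where "r = a mod int k"
      have a: "a = q * int k + r" unfolding q_def r_def by simp
      define v' where "v' = v - frag_cmul q w"
      have v'M: "v' \<in> M" unfolding v'_def w_def
        by (intro add_subgroup_diff[OF M] add_subgroup_cmul[OF M] v wM)
      have v'eq: "v' = frag_cmul r (x i) + (s - frag_cmul q s0)"
        unfolding v'_def w_def as a by (simp add: frag_cmul_distrib frag_cmul_distrib2 algebra_simps)
      have sL: "s - frag_cmul q s0 \<in> ?L" by (intro add_subgroup_diff[OF L] add_subgroup_cmul[OF L] as s0)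
      have "r = 0"
      proof (rule ccontr)
        assume "r \<noteq> 0"
        moreover have "0 \<le> r" "r < int k" unfolding r_def using k by auto
        ultimately show False using least[OF pos[of r, OF _ sL]] v'M v'eq by auto
      qed
      then have "v' \<in> M'" unfolding M'_def using v'M v'eq sL by simp
      moreover have "v = frag_cmul q w + v'" unfolding v'_def by simp
      ultimately show "v \<in> {frag_cmul a w + s | a s. s \<in> M'}" by blast
    qed
    moreover have "{frag_cmul a w + s | a s. s \<in> M'} \<subseteq> M"
      using add_subgroup_add[OF M] add_subgroup_cmul[OF M wM] unfolding w_def M'_def by auto
    ultimately show ?thesis using upd[of w] by (intro exI[of _ "y(i := w)"]) (simp del: fun_upd_apply)
  qed
qed

section \<open>From generators and relations to the homology group\<close>

lemma add_subgroup_relcycle: "add_subgroup (Collect (singular_relcycle p X T))"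
  unfolding add_subgroup_def by (auto simp: singular_relcycle_diff)

lemma add_subgroup_relboundary: "add_subgroup (Collect (singular_relboundary p X T))"
  unfolding add_subgroup_def by (auto simp: singular_relboundary_diff)

text \<open>The \<open>x i\<close> need not be cycles, so their span is first intersected with the
  cycles. With generators of the intersection adapted to the boundaries, sending coefficients to
  classes is onto, and two coefficient functions have the same image exactly when they agree modulo
  every \<open>m i\<close>. A modulus \<open>0\<close> gives an infinite cyclic factor, a modulus
  \<open>1\<close> a trivial one.\<close>

lemma homology_group_sum_of_cyclic:
  fixes x :: "nat \<Rightarrow> 'a chain"
  assumes gen: "\<And>z. singular_relcycle p X {} z \<Longrightarrow> \<exists>v\<in>lspan {..<n} x. singular_relboundary p X {} (v - z)"
  shows "\<exists>m :: nat \<Rightarrow> nat. homology_group (int p) X \<cong> sum_group {..<n} (\<lambda>i. integer_mod_group (m i))"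
proof -
  define Z where "Z = Collect (singular_relcycle p X {})"
  define B where "B = Collect (singular_relboundary p X {})"
  have Z: "add_subgroup Z" and B: "add_subgroup B"
    unfolding Z_def B_def by (rule add_subgroup_relcycle add_subgroup_relboundary)+
  have BZ: "B \<subseteq> Z" unfolding B_def Z_def using singular_relboundary_imp_relcycle by auto
  have "add_subgroup (lspan {..<n} x \<inter> Z)"
    using Z add_subgroup_lspan[of "{..<n}" x] unfolding add_subgroup_def by blast
  from subgroup_of_lspan[OF finite_lessThan this Int_lower1] obtain y0
    where y0: "lspan {..<n} y0 = lspan {..<n} x \<inter> Z" by blast
  have "\<exists>y (m :: nat \<Rightarrow> nat). lspan {..<n} y = lspan {..<n} y0 \<and>
      (\<forall>c. comb {..<n} c y \<in> B \<longleftrightarrow> (\<forall>i\<in>{..<n}. int (m i) dvd c i))"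
    by (rule adapted_generators[OF finite_lessThan B])
  then obtain y and m :: "nat \<Rightarrow> nat" where y: "lspan {..<n} y = lspan {..<n} y0"
    and m: "\<forall>c. comb {..<n} c y \<in> B \<longleftrightarrow> (\<forall>i\<in>{..<n}. int (m i) dvd c i)"
    by (elim exE conjE)
  define H where "H = homology_group (int p) X"
  define h where "h c = homologous_rel_set p X {} (comb {..<n} c y)" for c
  define A where "A = sum_group {..<n} (\<lambda>i. integer_mod_group (m i))"
  have carA: "carrier A = (\<Pi>\<^sub>E i\<in>{..<n}. carrier (integer_mod_group (m i)))"
    unfolding A_def by (simp add: carrier_sum_group)
  have h_eq: "h c = h d \<longleftrightarrow> (\<forall>i<n. int (m i) dvd c i - d i)" for c d
    using m[rule_format, of "\<lambda>i. c i - d i"]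
    unfolding h_def homologous_rel_set_eq B_def by (simp add: homologous_rel_def comb_diff Ball_def)
  have h_add: "h c \<otimes>\<^bsub>H\<^esub> h d = h (\<lambda>i. c i + d i)" for c d
  proof -
    let ?a = "comb {..<n} c y" and ?b = "comb {..<n} d y"
    \<comment> \<open>The product of two classes is the set of all sums of representatives, so every
      chain homologous to \<open>?a + ?b\<close> has to be split: it is
      \<open>?a + (v - ?a)\<close>.\<close>
    have "v \<in> (\<Union>r\<in>h c. \<Union>s\<in>h d. {r + s})" if "homologous_rel p X {} (?a + ?b) v" for v
    proof -
      have "v - ?a \<in> h d" unfolding h_def homologous_rel_def
        using that by (simp add: homologous_rel_def algebra_simps)
      moreover have "?a \<in> h c" unfolding h_def by simp
      ultimately show ?thesis by force
    qed
    then show ?thesis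
      unfolding H_def mult_relative_homology_group h_def comb_add[symmetric]
      by (auto intro: homologous_rel_add)
  qed
  have carH: "carrier H = range h"
  proof -
    have "h c \<in> carrier H" for c
    proof -
      have "comb {..<n} c y \<in> Z" using comb_in_lspan y y0 by blast
      then show ?thesis unfolding H_def carrier_relative_homology_group h_def Z_def by blast
    qed
    moreover have "homologous_rel_set p X {} z \<in> range h" if z: "singular_relcycle p X {} z" for z
    proof -
      from gen[OF z] obtain v where v: "v \<in> lspan {..<n} x" "v - z \<in> B" unfolding B_def by auto
      have "v \<in> Z" using add_subgroup_add[OF Z, of "v - z" z] v BZ z unfolding Z_def by auto
      then have "v \<in> lspan {..<n} y" using v y y0 by auto
      then obtain c where "v = comb {..<n} c y" by (rule lspanE)
      then have "homologous_rel_set p X {} z = h c"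
        using v unfolding h_def homologous_rel_set_eq B_def
        by (subst homologous_rel_sym) (simp add: homologous_rel_def)
      then show ?thesis by auto
    qed
    ultimately show ?thesis unfolding H_def carrier_relative_homology_group by auto
  qed
  \<comment> \<open>Since \<open>a mod 0 = a\<close>, the same normal form serves finite and
    infinite factors; \<open>h\<close> sees only the indices below \<open>n\<close>, so the
    restriction is harmless.\<close>
  have red: "h (\<lambda>i\<in>{..<n}. c i mod int (m i)) = h c" for c
    unfolding h_eq by (auto simp: mod_eq_dvd_iff[symmetric])
  have "h \<in> iso A H"
  proof (rule isoI)
    show "h \<in> hom A H"
    proof (rule homI)
      show "h c \<in> carrier H" for c using carH by auto
      show "h (c \<otimes>\<^bsub>A\<^esub> d) = h c \<otimes>\<^bsub>H\<^esub> h d" for c d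
        unfolding h_add A_def using red[of "\<lambda>i. c i + d i"] by simp
    qed
    show "bij_betw h (carrier A) (carrier H)"
    proof (rule bij_betw_imageI)
      show "inj_on h (carrier A)"
      proof (rule inj_onI)
        fix c d assume cd: "c \<in> carrier A" "d \<in> carrier A" and "h c = h d"
        have "c i = d i" if i: "i < n" for i
        proof -
          have "c i mod int (m i) = d i mod int (m i)"
            using \<open>h c = h d\<close> i unfolding h_eq by (simp add: mod_eq_dvd_iff)
          moreover have "c i \<in> carrier (integer_mod_group (m i))" "d i \<in> carrier (integer_mod_group (m i))"
            using cd i unfolding carA by auto
          ultimately show ?thesis by (auto simp: carrier_integer_mod_group split: if_splits)
        qed
        then show "c = d" using cd unfolding carA by (intro PiE_ext) auto
      qed
      have "(\<lambda>i\<in>{..<n}. c i mod int (m i)) \<in> carrier A" for c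
        unfolding carA by (auto simp: carrier_integer_mod_group)
      then have "h c \<in> h ` carrier A" for c using red[of c] by (metis imageI)
      then show "h ` carrier A = carrier H" unfolding carH by blast
    qed
  qed
  then have "A \<cong> H" unfolding is_iso_def by auto
  moreover have "group A" unfolding A_def by simp
  ultimately show ?thesis unfolding H_def A_def using group.iso_sym by blast
qed

section \<open>A capacitability argument in Cantor space\<close>

definition coin :: "(nat \<Rightarrow> bool) measure" where
  "coin = Pi\<^sub>M UNIV (\<lambda>_. uniform_count_measure (UNIV :: bool set))"

definition flip :: "nat \<Rightarrow> (nat \<Rightarrow> bool) \<Rightarrow> nat \<Rightarrow> bool" where
  "flip n \<alpha> = \<alpha>(n := \<not> \<alpha> n)"

text \<open>The hull of \<open>A\<close> among the sets determined by the first \<open>n\<close>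
  coordinates. The intersection of all these hulls is the closure of \<open>A\<close> in Cantor
  space, so \<open>K = (\<Inter>n. cyl n K)\<close> expresses that \<open>K\<close> is
  closed.\<close>

definition cyl :: "nat \<Rightarrow> (nat \<Rightarrow> bool) set \<Rightarrow> (nat \<Rightarrow> bool) set" where
  "cyl n A = {\<beta>. \<exists>\<alpha>\<in>A. \<forall>i<n. \<alpha> i = \<beta> i}"

lemma prob_space_coin: "prob_space coin"
  unfolding coin_def by (intro prob_space_PiM prob_space_uniform_count_measure) auto

lemma space_coin [simp]: "space coin = UNIV"
  unfolding coin_def by (simp add: space_PiM space_uniform_count_measure)

lemma coord_measurable [measurable]: "(\<lambda>\<alpha>. \<alpha> i) \<in> measurable coin (count_space UNIV)"
proof -
  have "sets (uniform_count_measure (UNIV :: bool set)) = sets (count_space UNIV)"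
    by (simp add: sets_uniform_count_measure)
  then show ?thesis unfolding coin_def
    using measurable_component_singleton[of i UNIV "\<lambda>_. uniform_count_measure (UNIV :: bool set)"]
      measurable_cong_sets by blast
qed

lemma flip_measurable [measurable]: "flip n \<in> measurable coin coin"
proof -
  have "(\<lambda>\<alpha>. flip n \<alpha> i) \<in> measurable coin (uniform_count_measure UNIV)" for i
  proof -
    have "(\<lambda>\<alpha>. flip n \<alpha> i) = (\<lambda>b. if i = n then \<not> b else b) \<circ> (\<lambda>\<alpha>. \<alpha> i)" by (auto simp: flip_def)
    moreover have "\<dots> \<in> measurable coin (uniform_count_measure UNIV)"
      by (rule measurable_comp[OF coord_measurable]) (simp add: space_uniform_count_measure)
    ultimately show ?thesis by simp
  qed
  then show ?thesis unfolding coin_def by (intro measurable_PiM_single') (auto simp: space_uniform_count_measure coin_def)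
qed

text \<open>A product measure is determined by its values on finite-dimensional boxes, and flipping
  only replaces the \<open>n\<close>-th side of a box by its preimage under \<open>Not\<close>,
  which has the same cardinality.\<close>

lemma flip_distr: "distr coin coin (flip n) = coin"
proof -
  let ?M = "uniform_count_measure (UNIV :: bool set)"
  interpret product_prob_space "\<lambda>_. ?M" UNIV
    by (intro product_prob_spaceI prob_space_uniform_count_measure) auto
  have "distr coin coin (flip n) = Pi\<^sub>M UNIV (\<lambda>_. ?M)"
  proof (rule PiM_eq)
    fix J :: "nat set" and F :: "nat \<Rightarrow> bool set"
    assume J: "finite J"
    define F' where "F' j = (if j = n then Not -` F j else F j)" for j
    have "card (Not -` A) = card A" for A
      by (rule bij_betw_same_card[of Not]) (auto intro!: bij_betwI[of _ _ _ Not])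
    then have F': "emeasure ?M (F' j) = emeasure ?M (F j)" for j
      unfolding F'_def by (simp add: emeasure_uniform_count_measure)
    have "flip n -` prod_emb UNIV (\<lambda>_. ?M) J (\<Pi>\<^sub>E j\<in>J. F j) = prod_emb UNIV (\<lambda>_. ?M) J (\<Pi>\<^sub>E j\<in>J. F' j)"
      by (auto simp: prod_emb_def flip_def F'_def PiE_iff space_uniform_count_measure split: if_splits)
    then have "emeasure (distr coin coin (flip n)) (prod_emb UNIV (\<lambda>_. ?M) J (\<Pi>\<^sub>E j\<in>J. F j))
      = emeasure coin (prod_emb UNIV (\<lambda>_. ?M) J (\<Pi>\<^sub>E j\<in>J. F' j))"
      using J by (subst emeasure_distr[OF flip_measurable]) (auto simp: coin_def intro!: sets_PiM_I)
    then show "emeasure (distr coin coin (flip n)) (prod_emb UNIV (\<lambda>_. ?M) J (\<Pi>\<^sub>E j\<in>J. F j))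
      = (\<Prod>j\<in>J. emeasure ?M (F j))"
      using J F' unfolding coin_def by (simp add: emeasure_PiM_emb)
  qed (simp add: coin_def)
  then show ?thesis by (simp add: coin_def)
qed

lemma cyl_measurable [measurable]: "cyl n A \<in> sets coin"
proof -
  have "cyl n A = (\<Union>f\<in>(\<lambda>\<alpha>. restrict \<alpha> {..<n}) ` A. {\<beta>\<in>space coin. \<forall>i\<in>{..<n}. \<beta> i = f i})"
    unfolding cyl_def by (auto intro: sym)
  moreover have "finite ((\<lambda>\<alpha>. restrict \<alpha> {..<n}) ` A)"
    by (rule finite_subset[of _ "{..<n} \<rightarrow>\<^sub>E UNIV"]) (auto intro: finite_PiE)
  ultimately show ?thesis
    by (simp only:) (intro sets.finite_UN; measurable)
qed

lemma cyl_flip: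
  assumes "n \<le> k" shows "\<beta> \<in> cyl n A \<longleftrightarrow> flip k \<beta> \<in> cyl n A"
  using assms unfolding cyl_def flip_def by auto


lemma emeasure_flip: "A \<in> sets coin \<Longrightarrow> emeasure coin (flip n -` A) = emeasure coin A"
  using emeasure_distr[OF flip_measurable, of A n] by (simp add: flip_distr)

lemma cyl_mono: "m \<le> n \<Longrightarrow> A \<subseteq> B \<Longrightarrow> cyl n A \<subseteq> cyl m B"
  unfolding cyl_def by (blast intro: less_le_trans)

lemma subset_cyl: "A \<subseteq> cyl n A"
  unfolding cyl_def by auto

text \<open>For large \<open>n\<close> both \<open>K\<close> and its image under \<open>flip n\<close> fill more than half of \<open>cyl n K\<close>.\<close>

lemma flip_in_positive_closed:
  assumes K: "K = (\<Inter>n. cyl n K)" and pos: "emeasure coin K > 0"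
  shows "\<exists>\<alpha> n. \<alpha> \<in> K \<and> flip n \<alpha> \<in> K"
proof (rule ccontr)
  assume no: "\<not> ?thesis"
  interpret prob_space coin by (rule prob_space_coin)
  have Km [measurable]: "K \<in> sets coin" by (subst K) measurable
  have "(\<lambda>n. measure coin (cyl n K)) \<longlonglongrightarrow> measure coin (\<Inter>n. cyl n K)"
    by (rule finite_Lim_measure_decseq) (auto simp: decseq_def cyl_mono)
  then have lim: "(\<lambda>n. measure coin (cyl n K)) \<longlonglongrightarrow> measure coin K"
    unfolding K[symmetric] .
  have mpos: "measure coin K > 0" using pos by (simp add: emeasure_eq_measure)
  then have "\<forall>\<^sub>F n in sequentially. measure coin (cyl n K) < 2 * measure coin K"
    by (intro order_tendstoD(2)[OF lim]) simp
  then obtain n where n: "measure coin (cyl n K) < 2 * measure coin K"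
    by (auto simp: eventually_sequentially)
  let ?F = "flip n -` K"
  have Fm [measurable]: "?F \<in> sets coin" using measurable_sets[OF flip_measurable Km, of n] by simp
  have "measure coin ?F = measure coin K" unfolding measure_def by (simp add: emeasure_flip)
  moreover have "K \<inter> ?F = {}" using no by auto
  ultimately have "measure coin (K \<union> ?F) = 2 * measure coin K"
    by (simp add: finite_measure_Union)
  moreover have "K \<union> ?F \<subseteq> cyl n K" using subset_cyl[of K n] cyl_flip[of n n _ K] by auto
  ultimately show False using n finite_measure_mono[of "K \<union> ?F" "cyl n K"] by simp
qed

text \<open>Choquet's capacitability argument: choose \<open>b\<close> step by step so that the outer measure of
  \<open>A (b 0, \<dots>, b (n - 1))\<close> stays above \<open>c\<close>; then the intersection of the cylinder hulls is a closed
  subset of \<open>A []\<close> of measure at least \<open>c\<close>.\<close>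

lemma increasing_scheme_flip_pair:
  fixes A :: "nat list \<Rightarrow> (nat \<Rightarrow> bool) set"
  assumes Un: "\<And>s. A s = (\<Union>i. A (s @ [i]))"
    and mono: "\<And>s i j. i \<le> j \<Longrightarrow> A (s @ [i]) \<subseteq> A (s @ [j])"
    and closed: "\<And>b \<beta>. (\<And>n. \<exists>\<alpha>\<in>A (map b [0..<n]). \<forall>i<n. \<alpha> i = \<beta> i) \<Longrightarrow> \<beta> \<in> A []"
    and pos: "outer_measure_of coin (A []) > 0"
  shows "\<exists>\<alpha> n. \<alpha> \<in> A [] \<and> flip n \<alpha> \<in> A []"
proof -
  interpret prob_space coin by (rule prob_space_coin)
  from pos obtain c where c: "0 < c" "c < outer_measure_of coin (A [])" by (meson dense)
  have step: "\<exists>i. c < outer_measure_of coin (A (s @ [i]))" if "c < outer_measure_of coin (A s)" for s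
  proof -
    have "outer_measure_of coin (A s) = (SUP i. outer_measure_of coin (A (s @ [i])))"
      by (subst SUP_outer_measure_of_incseq) (auto simp: incseq_def mono Un[of s, symmetric])
    then show ?thesis using that by (simp add: less_SUP_iff)
  qed
  define ext where "ext s = (SOME i. c < outer_measure_of coin (A (s @ [i])))" for s
  define w where "w = rec_nat [] (\<lambda>_ s. s @ [ext s])"
  have w: "w 0 = []" "w (Suc n) = w n @ [ext (w n)]" for n unfolding w_def by simp_all
  have wc: "c < outer_measure_of coin (A (w n))" for n
    by (induction n) (use c step in \<open>auto simp: w ext_def intro: someI_ex\<close>)
  define b where "b n = ext (w n)" for n
  have wb: "w n = map b [0..<n]" for n by (induction n) (auto simp: w b_def)
  have dec: "A (w n) \<subseteq> A (w m)" if "m \<le> n" for m n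
  proof -
    have "A (w (Suc k)) \<subseteq> A (w k)" for k using Un[of "w k"] unfolding w by blast
    then show ?thesis using that by (rule lift_Suc_antimono_le)
  qed
  define K where "K = (\<Inter>n. cyl n (A (w n)))"
  have "K \<subseteq> A []"
  proof
    fix \<beta> assume \<beta>: "\<beta> \<in> K"
    show "\<beta> \<in> A []"
    proof (rule closed)
      show "\<exists>\<alpha>\<in>A (map b [0..<n]). \<forall>i<n. \<alpha> i = \<beta> i" for n
        using \<beta> unfolding K_def cyl_def wb by auto
    qed
  qed
  have "emeasure coin K \<ge> c"
  proof -
    have eq: "(INF n. emeasure coin (cyl n (A (w n)))) = emeasure coin K"
      unfolding K_def by (rule INF_emeasure_decseq) (auto simp: decseq_def cyl_mono dec)
    have "c \<le> emeasure coin (cyl n (A (w n)))" for n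
    proof -
      have "c \<le> outer_measure_of coin (A (w n))" using wc by (simp add: less_imp_le)
      also have "\<dots> \<le> outer_measure_of coin (cyl n (A (w n)))" by (intro outer_measure_of_mono subset_cyl)
      finally show ?thesis by simp
    qed
    then show ?thesis unfolding eq[symmetric] by (rule INF_greatest)
  qed
  moreover have "K = (\<Inter>n. cyl n K)"
  proof
    show "K \<subseteq> (\<Inter>n. cyl n K)" using subset_cyl by blast
    have "cyl n K \<subseteq> cyl n (A (w n))" for n
    proof
      fix \<beta> assume "\<beta> \<in> cyl n K"
      then obtain \<alpha> where "\<alpha> \<in> K" "\<forall>i<n. \<alpha> i = \<beta> i" unfolding cyl_def by auto
      then have "\<alpha> \<in> cyl n (A (w n))" unfolding K_def by auto
      then show "\<beta> \<in> cyl n (A (w n))" using \<open>\<forall>i<n. \<alpha> i = \<beta> i\<close> unfolding cyl_def by auto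
    qed
    then have "(\<Inter>n. cyl n K) \<subseteq> (\<Inter>n. cyl n (A (w n)))" by blast
    then show "(\<Inter>n. cyl n K) \<subseteq> K" unfolding K_def[symmetric] .
  qed
  ultimately show ?thesis using flip_in_positive_closed[of K] c \<open>K \<subseteq> A []\<close> by fastforce
qed

text \<open>A set of outer measure zero has a measurable hull of measure zero, and countably many
  null hulls cannot cover a probability space.\<close>

lemma countable_cover_outer_pos:
  assumes "countable C" "(\<Union>c\<in>C. A c) = (UNIV :: (nat \<Rightarrow> bool) set)"
  shows "\<exists>c\<in>C. outer_measure_of coin (A c) > 0"
proof (rule ccontr)
  interpret prob_space coin by (rule prob_space_coin)
  assume "\<not> ?thesis"
  then have zero: "outer_measure_of coin (A c) = 0" if "c \<in> C" for c using that by (auto simp: not_gr_zero)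
  have "\<forall>c. \<exists>E\<in>sets coin. A c \<subseteq> E \<and> outer_measure_of coin (A c) = emeasure coin E"
    by (intro allI outer_measure_of_attain) simp
  then obtain E where E: "\<And>c. E c \<in> sets coin" "\<And>c. A c \<subseteq> E c"
    "\<And>c. outer_measure_of coin (A c) = emeasure coin (E c)" by metis
  have "(\<Union>c\<in>C. E c) \<in> null_sets coin"
    by (rule null_sets_UN'[OF assms(1)]) (use E zero in auto)
  moreover have "(\<Union>c\<in>C. E c) = space coin" using assms(2) E(2) unfolding space_coin by blast
  ultimately show False using emeasure_space_1 by (simp add: null_sets_def)
qed

section \<open>Paths in compact locally connected spaces\<close>

text \<open>If no walk through overlapping balls led from \<open>x\<close> to \<open>y\<close>, the
  reachable and the unreachable balls would separate \<open>C\<close>. The admissible lengths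
  \<open>N\<close> depend on the cover alone, so that all links of one stage can be refined into
  equally many pieces; shorter chains are padded at \<open>y\<close>.\<close>

lemma connected_chain:
  fixes C :: "'a::metric_space set"
  assumes F: "finite F" and cov: "C \<subseteq> (\<Union>p\<in>F. ball p (\<delta>/2))" and C: "connected C"
    and xy: "x \<in> C" "y \<in> C"
    and N: "Suc (card (F \<times> F)) \<le> N"
  shows "\<exists>h. h 0 = x \<and> h N = y \<and> (\<forall>i\<le>N. h i \<in> C) \<and> (\<forall>i<N. dist (h i) (h (Suc i)) < \<delta>)"
proof -
  let ?B = "\<lambda>p. ball p (\<delta>/2)"
  define r where "r = {(p, q). p \<in> F \<and> q \<in> F \<and> ?B p \<inter> ?B q \<inter> C \<noteq> {}}"
  define R where "R = {(a, b). a \<in> C \<and> b \<in> C \<and> dist a b < \<delta>}"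
  have rF: "r \<subseteq> F \<times> F" unfolding r_def by auto
  have fr: "finite r" using rF F by (meson finite_SigmaI finite_subset)
  have near: "(a, b) \<in> R" if "a \<in> C" "b \<in> C" "a \<in> ?B p" "b \<in> ?B p" for a b p
    using that dist_triangle_half_r[of p a \<delta> b] unfolding R_def by (auto simp: dist_commute)
  obtain p where p: "p \<in> F" "x \<in> ?B p" using cov xy by blast
  have "\<exists>q. (p, q) \<in> r\<^sup>* \<and> y \<in> ?B q"
  proof (rule ccontr)
    assume no: "\<not> ?thesis"
    define U where "U = (\<Union>q\<in>r\<^sup>* `` {p}. ?B q)"
    define V where "V = (\<Union>q\<in>F - r\<^sup>* `` {p}. ?B q)"
    have "open U" "open V" unfolding U_def V_def by auto
    moreover have "x \<in> U \<inter> C" unfolding U_def using p xy by auto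
    moreover have "y \<in> V \<inter> C" using no cov xy unfolding V_def by blast
    moreover have "C \<subseteq> U \<union> V" using cov unfolding U_def V_def by blast
    moreover have "U \<inter> V \<inter> C = {}"
    proof (rule ccontr)
      assume "U \<inter> V \<inter> C \<noteq> {}"
      then obtain z q q' where z: "z \<in> C" "(p, q) \<in> r\<^sup>*" "z \<in> ?B q" "q' \<in> F" "(p, q') \<notin> r\<^sup>*" "z \<in> ?B q'"
        unfolding U_def V_def by blast
      have "q \<in> F" using z(2) p(1) rF by (induction rule: rtrancl_induct) auto
      then have "(q, q') \<in> r" unfolding r_def using z by blast
      then show False using z by (meson rtrancl.rtrancl_into_rtrancl)
    qed
    ultimately show False using C unfolding connected_def by blast
  qed
  then obtain q n where q: "(p, q) \<in> r ^^ n" "n \<le> card r" "y \<in> ?B q"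
    unfolding rtrancl_finite_eq_relpow[OF fr] by auto
  \<comment> \<open>A walk with \<open>n\<close> overlaps supplies \<open>n\<close> intermediate
    points of \<open>C\<close>, hence \<open>n + 1\<close> jumps, each inside a single ball of
    radius \<open>\<delta>/2\<close>.\<close>
  have "(x', y) \<in> R ^^ Suc n" if "(p', q) \<in> r ^^ n" "x' \<in> C" "x' \<in> ?B p'" for n x' p'
    using that
  proof (induction n arbitrary: x' p')
    case 0 then show ?case using near[of x' y p'] q xy by auto
  next
    case (Suc n)
    from Suc.prems(1) obtain p'' where p'': "(p', p'') \<in> r" "(p'', q) \<in> r ^^ n" by (rule relpow_Suc_E2)
    then obtain z where z: "z \<in> C" "z \<in> ?B p'" "z \<in> ?B p''" unfolding r_def by blast
    have "(x', z) \<in> R" using near Suc.prems z by blast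
    moreover have "(z, y) \<in> R ^^ Suc n" using Suc.IH p'' z by blast
    ultimately show ?case by (rule relpow_Suc_I2)
  qed
  then have path: "(x, y) \<in> R ^^ Suc n" using q xy p by blast
  have "0 < \<delta>" using p zero_le_dist[of p x] by (simp del: zero_le_dist)
  then have refl: "(y, y) \<in> R" unfolding R_def using xy by simp
  have "Suc n \<le> N" using q(2) N card_mono[OF _ rF] F by fastforce
  then have "(x, y) \<in> R ^^ N"
    using path by (induction N rule: dec_induct) (auto intro: relpow_Suc_I refl)
  then obtain h where h: "h 0 = x" "h N = y" "\<forall>i<N. (h i, h (Suc i)) \<in> R"
    unfolding relpow_fun_conv by auto
  have "h i \<in> C" if "i \<le> N" for i
    using h that xy unfolding R_def by (cases i) auto
  then show ?thesis using h unfolding R_def by (intro exI[of _ h]) auto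
qed

text \<open>\<open>\<delta>\<close> is a Lebesgue number of a cover by open sets whose traces on
  \<open>S\<close> lie in connected subsets of balls of radius \<open>\<epsilon>/2\<close>.\<close>

lemma compact_locally_connected_uniform:
  fixes S :: "'a::metric_space set"
  assumes S: "compact S" "locally connected S" and e: "0 < \<epsilon>"
  shows "\<exists>\<delta>>0. \<forall>x\<in>S. \<forall>y\<in>S. dist x y < \<delta> \<longrightarrow>
    (\<exists>C. connected C \<and> C \<subseteq> S \<and> x \<in> C \<and> y \<in> C \<and> (\<forall>a\<in>C. \<forall>b\<in>C. dist a b < \<epsilon>))"
proof -
  have "\<exists>T C. open T \<and> connected C \<and> z \<in> T \<and> S \<inter> T \<subseteq> C \<and> C \<subseteq> S \<inter> ball z (\<epsilon>/2)" if z: "z \<in> S" for z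
  proof -
    have "openin (top_of_set S) (S \<inter> ball z (\<epsilon>/2))" by auto
    moreover have "z \<in> S \<inter> ball z (\<epsilon>/2)" using z e by auto
    ultimately obtain u v where "openin (top_of_set S) u" "connected v" "z \<in> u" "u \<subseteq> v"
      "v \<subseteq> S \<inter> ball z (\<epsilon>/2)" using S(2) unfolding locally_def by metis
    moreover obtain T where "open T" "u = S \<inter> T" using \<open>openin (top_of_set S) u\<close> unfolding openin_open by auto
    ultimately show ?thesis by blast
  qed
  then obtain T C where TC: "\<And>z. z \<in> S \<Longrightarrow> open (T z) \<and> connected (C z) \<and> z \<in> T z \<and> S \<inter> T z \<subseteq> C z
      \<and> C z \<subseteq> S \<inter> ball z (\<epsilon>/2)" by metis
  obtain \<delta> where d: "0 < \<delta>" "\<And>x. x \<in> S \<Longrightarrow> \<exists>G\<in>T ` S. ball x \<delta> \<subseteq> G"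
    by (rule Heine_Borel_lemma[OF S(1), of "T ` S"]) (use TC in blast)+
  show ?thesis
  proof (intro exI[of _ \<delta>] conjI ballI impI)
    fix x y assume xy: "x \<in> S" "y \<in> S" "dist x y < \<delta>"
    from d(2)[OF xy(1)] obtain z where z: "z \<in> S" "ball x \<delta> \<subseteq> T z" by auto
    have "x \<in> ball x \<delta>" "y \<in> ball x \<delta>" using xy d(1) by auto
    then have "x \<in> C z" "y \<in> C z" using z(2) xy TC[OF z(1)] by blast+
    moreover have "dist a b < \<epsilon>" if "a \<in> C z" "b \<in> C z" for a b
      using that TC[OF z(1)] dist_triangle_half_r[of z a \<epsilon> b] by (auto simp: subset_iff)
    ultimately show "\<exists>C. connected C \<and> C \<subseteq> S \<and> x \<in> C \<and> y \<in> C \<and> (\<forall>a\<in>C. \<forall>b\<in>C. dist a b < \<epsilon>)"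
      using TC[OF z(1)] by (intro exI[of _ "C z"]) auto
  qed (rule d)
qed

text \<open>\<open>X k\<close> is the chain of stage \<open>k\<close>, continued beyond \<open>y\<close> by chains from \<open>y\<close> to \<open>y\<close> so that no end point
  needs a special case; \<open>f k\<close> is the corresponding step function.\<close>

lemma path_of_refining_chains:
  fixes S :: "'a::metric_space set" and R :: "nat \<Rightarrow> ('a \<times> 'a) set"
  assumes S: "compact S" and e: "0 < \<epsilon>"
    and RS: "\<And>k x y. (x, y) \<in> R k \<Longrightarrow> x \<in> S \<and> y \<in> S \<and> dist x y < \<epsilon> / 2 ^ k"
    and refl: "\<And>k x. x \<in> S \<Longrightarrow> (x, x) \<in> R k"
    and N: "\<And>k. 2 \<le> N k"
    and step: "\<And>k x y. (x, y) \<in> R k \<Longrightarrow> \<exists>h. h 0 = x \<and> h (N k) = y \<and>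
       (\<forall>i<N k. (h i, h (Suc i)) \<in> R (Suc k)) \<and> (\<forall>i\<le>N k. dist x (h i) < \<epsilon> / 2 ^ k)"
    and xy: "(x, y) \<in> R 0"
  shows "\<exists>g. path g \<and> path_image g \<subseteq> S \<inter> ball x (4 * \<epsilon>) \<and> pathstart g = x \<and> pathfinish g = y"
proof -
  have "\<forall>k p. \<exists>h. p \<in> R k \<longrightarrow> h 0 = fst p \<and> h (N k) = snd p \<and>
       (\<forall>i<N k. (h i, h (Suc i)) \<in> R (Suc k)) \<and> (\<forall>i\<le>N k. dist (fst p) (h i) < \<epsilon> / 2 ^ k)"
    using step by (metis prod.collapse)
  then obtain H where H: "\<And>k p. p \<in> R k \<Longrightarrow> H k p 0 = fst p \<and> H k p (N k) = snd p \<and>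
       (\<forall>i<N k. (H k p i, H k p (Suc i)) \<in> R (Suc k)) \<and> (\<forall>i\<le>N k. dist (fst p) (H k p i) < \<epsilon> / 2 ^ k)"
    by metis
  \<comment> \<open>Point \<open>j\<close> of stage \<open>k + 1\<close> stands at position
    \<open>j mod N k\<close> in the refinement of link number \<open>j div N k\<close> of stage
    \<open>k\<close>.\<close>
  define X where "X = rec_nat (\<lambda>j::nat. if j = 0 then x else y)
     (\<lambda>k X j. H k (X (j div N k), X (Suc (j div N k))) (j mod N k))"
  have X0: "X 0 j = (if j = 0 then x else y)" for j unfolding X_def by simp
  have XS: "X (Suc k) j = H k (X k (j div N k), X k (Suc (j div N k))) (j mod N k)" for k j
    unfolding X_def by simp
  have Npos: "0 < N k" for k using N[of k] by simp
  have XR: "(X k j, X k (Suc j)) \<in> R k" for k j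
  proof (induction k arbitrary: j)
    case 0 then show ?case using xy refl RS[OF xy] by (auto simp: X0)
  next
    case (Suc k)
    let ?p = "\<lambda>j. (X k (j div N k), X k (Suc (j div N k)))"
    have h: "(H k (?p j) (j mod N k), H k (?p j) (Suc (j mod N k))) \<in> R (Suc k)"
      using H[OF Suc.IH] Npos by (simp add: mod_less_divisor)
    show ?case
    proof (cases "Suc (j mod N k) = N k")
      case True
      then have j: "Suc j div N k = Suc (j div N k)" "Suc j mod N k = 0"
        by (simp_all add: div_Suc mod_Suc)
      then have "X (Suc k) (Suc j) = X k (Suc (j div N k))" unfolding XS using H[OF Suc.IH] by simp
      moreover have "H k (?p j) (Suc (j mod N k)) = X k (Suc (j div N k))"
        unfolding True using H[OF Suc.IH[of "j div N k"]] by simp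
      ultimately show ?thesis using h unfolding XS[of k j] by simp
    next
      case False
      then have j: "Suc j div N k = j div N k" "Suc j mod N k = Suc (j mod N k)"
        by (simp_all add: div_Suc mod_Suc)
      then show ?thesis using h unfolding XS by simp
    qed
  qed
  have XinS: "X k j \<in> S" for k j using RS[OF XR] by blast
  \<comment> \<open>\<open>P k\<close> is the number of links between \<open>x\<close> and
    \<open>y\<close> at stage \<open>k\<close>; the step function spends time \<open>1 / P k\<close>
    on each.\<close>
  define P where "P k = (\<Prod>i<k. N i)" for k
  have P: "P 0 = 1" "P (Suc k) = P k * N k" for k unfolding P_def by simp_all
  have Pge: "2 ^ k \<le> P k" for k
    by (induction k) (use N in \<open>auto simp: P mult.commute intro: mult_mono\<close>)
  then have Ppos: "0 < P k" for k by (metis less_le_trans zero_less_numeral zero_less_power)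
  define f where "f k t = X k (nat \<lfloor>t * real (P k)\<rfloor>)" for k t
  have fS: "f k t \<in> S" for k t unfolding f_def by (rule XinS)
  \<comment> \<open>Floors of nested subdivisions are compatible: the link of stage
    \<open>k + 1\<close> in use at time \<open>t\<close> belongs to the refinement of the link of
    stage \<open>k\<close> in use at time \<open>t\<close>.\<close>
  have floor_div: "nat \<lfloor>t * real (P (Suc k))\<rfloor> div N k = nat \<lfloor>t * real (P k)\<rfloor>" if "0 \<le> t" for k and t :: real
  proof -
    have "\<lfloor>t * real (P (Suc k))\<rfloor> div int (N k) = \<lfloor>t * real (P (Suc k)) / real (N k)\<rfloor>"
      by (metis floor_divide_real_eq_div of_int_of_nat_eq of_nat_0_le_iff)
    also have "t * real (P (Suc k)) / real (N k) = t * real (P k)" using Npos[of k] by (simp add: P)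
    finally show ?thesis by (metis nat_int of_nat_0_le_iff nat_div_distrib' )
  qed
  have close: "dist (f k t) (f (Suc k) t) < \<epsilon> / 2 ^ k" if "0 \<le> t" for k t
  proof -
    define j where "j = nat \<lfloor>t * real (P (Suc k))\<rfloor>"
    have "f k t = X k (j div N k)" unfolding f_def j_def floor_div[OF that] ..
    moreover have "f (Suc k) t = H k (X k (j div N k), X k (Suc (j div N k))) (j mod N k)"
      unfolding f_def j_def[symmetric] XS ..
    ultimately show ?thesis using H[OF XR[of k "j div N k"]] Npos by (simp add: less_imp_le)
  qed
  have f0: "f k 0 = x" for k
    by (induction k) (use H[OF XR] in \<open>auto simp: f_def X0 XS\<close>)
  have f1: "f k 1 = y" for k
  proof (induction k)
    case 0 then show ?case by (simp add: f_def X0 P)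
  next
    case (Suc k)
    have "f (Suc k) 1 = X k (P k)" unfolding f_def P using H[OF XR[of k "P k"]] Npos[of k]
      by (simp add: XS flip: of_nat_mult)
    then show ?case using Suc unfolding f_def by simp
  qed
  have far: "dist (f k t) (f (k + m) t) \<le> 2 * \<epsilon> / 2 ^ k * (1 - 1 / 2 ^ m)" if "0 \<le> t" for k m t
  proof (induction m)
    case (Suc m)
    have "dist (f k t) (f (k + Suc m) t) \<le> dist (f k t) (f (k + m) t) + dist (f (k + m) t) (f (k + Suc m) t)"
      by (rule dist_triangle)
    also have "\<dots> \<le> 2 * \<epsilon> / 2 ^ k * (1 - 1 / 2 ^ m) + \<epsilon> / 2 ^ (k + m)"
      using Suc close[OF that, of "k + m"] by simp
    also have "\<dots> = 2 * \<epsilon> / 2 ^ k * (1 - 1 / 2 ^ Suc m)" by (simp add: field_simps power_add)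
    finally show ?case .
  qed simp
  have far': "dist (f k t) (f (k + m) t) \<le> 2 * \<epsilon> / 2 ^ k" if "0 \<le> t" for k m t
  proof -
    have "2 * \<epsilon> / 2 ^ k * (1 - 1 / 2 ^ m) \<le> 2 * \<epsilon> / 2 ^ k * 1"
      using e by (intro mult_left_mono) auto
    then show ?thesis using far[OF that, of k m] by simp
  qed
  have small: "\<exists>k. C * \<epsilon> / 2 ^ k < r" if "0 < r" for C r :: real
  proof -
    have "(\<lambda>k. C * \<epsilon> * (1 / 2) ^ k) \<longlonglongrightarrow> C * \<epsilon> * 0"
      by (intro tendsto_mult tendsto_const LIMSEQ_power_zero) simp
    then have "\<forall>\<^sub>F k in sequentially. C * \<epsilon> * (1 / 2) ^ k < r" using that by (intro order_tendstoD(2)) auto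
    then show ?thesis by (auto simp: eventually_sequentially power_one_over)
  qed
  have "\<exists>l\<in>S. (\<lambda>k. f k t) \<longlonglongrightarrow> l" if t: "0 \<le> t" for t
  proof -
    have "Cauchy (\<lambda>k. f k t)"
    proof (rule metric_CauchyI)
      fix r :: real assume "0 < r"
      from small[OF this, of 4] obtain K where K: "4 * \<epsilon> / 2 ^ K < r" by auto
      have "dist (f m t) (f n t) < r" if "K \<le> m" "K \<le> n" for m n
      proof -
        have "dist (f K t) (f m t) \<le> 2 * \<epsilon> / 2 ^ K" "dist (f K t) (f n t) \<le> 2 * \<epsilon> / 2 ^ K"
          using far'[OF t, of K "m - K"] far'[OF t, of K "n - K"] that by auto
        then show ?thesis using dist_triangle3[of "f m t" "f n t" "f K t"] K by simp
      qed
      then show "\<exists>K. \<forall>m\<ge>K. \<forall>n\<ge>K. dist (f m t) (f n t) < r" by blast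
    qed
    then obtain l where "l \<in> S" "(\<lambda>k. f k t) \<longlonglongrightarrow> l"
      by (rule completeE[OF compact_imp_complete[OF S] allI[OF fS]])
    then show ?thesis by blast
  qed
  then have "\<forall>t. \<exists>l. 0 \<le> t \<longrightarrow> l \<in> S \<and> (\<lambda>k. f k t) \<longlonglongrightarrow> l" by blast
  from choice[OF this] obtain g
    where g: "\<And>t. 0 \<le> t \<Longrightarrow> g t \<in> S" "\<And>t. 0 \<le> t \<Longrightarrow> (\<lambda>k. f k t) \<longlonglongrightarrow> g t" by blast
  have fg: "dist (f k t) (g t) \<le> 2 * \<epsilon> / 2 ^ k" if "0 \<le> t" for k t
  proof (rule tendsto_upperbound)
    show "(\<lambda>m. dist (f k t) (f (m + k) t)) \<longlonglongrightarrow> dist (f k t) (g t)"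
      by (intro tendsto_dist tendsto_const LIMSEQ_ignore_initial_segment g that)
    show "\<forall>\<^sub>F m in sequentially. dist (f k t) (f (m + k) t) \<le> 2 * \<epsilon> / 2 ^ k"
      using far'[OF that, of k] by (simp add: add.commute)
  qed simp
  have gf0: "g 0 = x" using g(2)[of 0] LIMSEQ_unique[OF _ tendsto_const] unfolding f0 by simp
  have gf1: "g 1 = y" using g(2)[of 1] LIMSEQ_unique[OF _ tendsto_const] unfolding f1 by simp
  have fclose: "dist (f k s) (f k t) \<le> \<epsilon> / 2 ^ k" if st: "0 \<le> s" "s \<le> t" "t - s < 1 / real (P k)" for s t k
  proof -
    define a where "a = nat \<lfloor>s * real (P k)\<rfloor>"
    define b where "b = nat \<lfloor>t * real (P k)\<rfloor>"
    have "t * real (P k) < s * real (P k) + 1" using st(3) Ppos[of k] by (simp add: field_simps)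
    moreover have "s * real (P k) \<le> t * real (P k)" using st by (simp add: mult_right_mono)
    ultimately have "a \<le> b \<and> b \<le> Suc a" unfolding a_def b_def by linarith
    then have "b = a \<or> b = Suc a" by auto
    then show ?thesis using RS[OF XR[of k a]] e unfolding f_def a_def[symmetric] b_def[symmetric] by auto
  qed
  \<comment> \<open>The constant is \<open>2 + 1 + 2\<close>: the tail estimate \<open>fg\<close> at
    both times and one link of stage \<open>k\<close> in between.\<close>
  have gclose: "dist (g s) (g t) \<le> 5 * \<epsilon> / 2 ^ k" if st: "0 \<le> s" "0 \<le> t" "\<bar>t - s\<bar> < 1 / real (P k)" for s t k
  proof -
    have "dist (f k s) (f k t) \<le> \<epsilon> / 2 ^ k"
      using fclose[of s t k] fclose[of t s k] st by (cases "s \<le> t") (auto simp: dist_commute abs_if split: if_splits)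
    moreover have "dist (g s) (g t) \<le> dist (g s) (f k s) + dist (f k s) (f k t) + dist (f k t) (g t)"
      using dist_triangle[of "g s" "g t" "f k s"] dist_triangle[of "f k s" "g t" "f k t"] by linarith
    ultimately show ?thesis using fg[OF st(1), of k] fg[OF st(2), of k] by (simp add: dist_commute)
  qed
  have "continuous_on {0..1} g"
    unfolding continuous_on_iff
  proof (intro ballI allI impI)
    fix t r :: real assume t: "t \<in> {0..1}" and r: "0 < r"
    from small[OF r, of 5] obtain k where k: "5 * \<epsilon> / 2 ^ k < r" by auto
    show "\<exists>d>0. \<forall>s\<in>{0..1}. dist s t < d \<longrightarrow> dist (g s) (g t) < r"
    proof (intro exI[of _ "1 / real (P k)"] conjI ballI impI)
      fix s :: real assume s: "s \<in> {0..1}" "dist s t < 1 / real (P k)"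
      have "dist (g s) (g t) \<le> 5 * \<epsilon> / 2 ^ k"
        using s t by (intro gclose) (auto simp: dist_real_def abs_minus_commute)
      then show "dist (g s) (g t) < r" using k by simp
    qed (use Ppos in simp)
  qed
  moreover have "g ` {0..1} \<subseteq> S \<inter> ball x (4 * \<epsilon>)"
  proof
    fix z assume "z \<in> g ` {0..1}"
    then obtain t where t: "t \<in> {0..1}" "z = g t" by auto
    \<comment> \<open>Stage \<open>0\<close> has only the values \<open>x\<close> and
      \<open>y\<close>, so it contributes at most \<open>\<epsilon>\<close>; the tail adds at most
      \<open>2 * \<epsilon>\<close>, which stays inside the ball of radius
      \<open>4 * \<epsilon>\<close>.\<close>
    have "f 0 t = x \<or> f 0 t = y" unfolding f_def X0 by auto
    then have "dist x (f 0 t) \<le> \<epsilon>" using RS[OF xy] e by auto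
    then show "z \<in> S \<inter> ball x (4 * \<epsilon>)"
      using t g(1)[of t] fg[of t 0] dist_triangle[of x "g t" "f 0 t"] e by auto
  qed
  ultimately show ?thesis
    by (intro exI[of _ g]) (auto simp: path_def path_image_def pathstart_def pathfinish_def gf0 gf1)
qed

text \<open>Points are related at stage \<open>k\<close> if a connected subset of \<open>S\<close>
  of size below \<open>\<eta> / 2 ^ k\<close> contains both. A fine chain inside that set refines
  the link, because its consecutive points are close enough to be related at stage
  \<open>k + 1\<close>. The factor \<open>4\<close> in \<open>\<eta>\<close> matches the radius in
  \<open>path_of_refining_chains\<close>.\<close>

lemma compact_locally_connected_uniformly_locally_path_connected:
  fixes S :: "'a::metric_space set"
  assumes S: "compact S" "locally connected S" and e: "0 < \<epsilon>"
  shows "\<exists>\<delta>>0. \<forall>x\<in>S. \<forall>y\<in>S. dist x y < \<delta> \<longrightarrow>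
    (\<exists>g. path g \<and> path_image g \<subseteq> S \<inter> ball x \<epsilon> \<and> pathstart g = x \<and> pathfinish g = y)"
proof -
  define \<eta> where "\<eta> = \<epsilon> / 4"
  have eta: "0 < \<eta> / 2 ^ k" for k :: nat using e unfolding \<eta>_def by simp
  define R where "R k = {(x, y). \<exists>C. connected C \<and> C \<subseteq> S \<and> x \<in> C \<and> y \<in> C \<and> (\<forall>a\<in>C. \<forall>b\<in>C. dist a b < \<eta> / 2 ^ k)}"
    for k :: nat
  obtain \<delta> where d: "\<And>k. 0 < \<delta> k" "\<And>k x y. x \<in> S \<Longrightarrow> y \<in> S \<Longrightarrow> dist x y < \<delta> k \<Longrightarrow> (x, y) \<in> R k"
    using compact_locally_connected_uniform[OF S eta] unfolding R_def by simp metis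
  have "\<exists>F. finite F \<and> S \<subseteq> (\<Union>p\<in>F. ball p (\<delta> (Suc k) / 2))" for k
    using S(1) d(1)[of "Suc k"] unfolding compact_eq_totally_bounded
    by (metis half_gt_zero)
  then obtain F where F: "\<And>k. finite (F k)" "\<And>k. S \<subseteq> (\<Union>p\<in>F k. ball p (\<delta> (Suc k) / 2))" by metis
  define N where "N k = card (F k \<times> F k) + 2" for k
  show ?thesis
  proof (intro exI[of _ "\<delta> 0"] conjI ballI impI)
    fix x y assume xy: "x \<in> S" "y \<in> S" "dist x y < \<delta> 0"
    have "\<exists>g. path g \<and> path_image g \<subseteq> S \<inter> ball x (4 * \<eta>) \<and> pathstart g = x \<and> pathfinish g = y"
    proof (rule path_of_refining_chains[OF S(1), of \<eta> R N])
      show "0 < \<eta>" using e unfolding \<eta>_def by simp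
      show "a \<in> S \<and> b \<in> S \<and> dist a b < \<eta> / 2 ^ k" if "(a, b) \<in> R k" for k a b
        using that unfolding R_def by auto
      show "(a, a) \<in> R k" if "a \<in> S" for k a
        using d that by simp
      show "2 \<le> N k" for k unfolding N_def by simp
      show "(x, y) \<in> R 0" using d xy by blast
      show "\<exists>h. h 0 = a \<and> h (N k) = b \<and> (\<forall>i<N k. (h i, h (Suc i)) \<in> R (Suc k)) \<and>
          (\<forall>i\<le>N k. dist a (h i) < \<eta> / 2 ^ k)" if "(a, b) \<in> R k" for k a b
      proof -
        from that obtain C where C: "connected C" "C \<subseteq> S" "a \<in> C" "b \<in> C" "\<forall>a\<in>C. \<forall>b\<in>C. dist a b < \<eta> / 2 ^ k"
          unfolding R_def by blast
        have "\<exists>h. h 0 = a \<and> h (N k) = b \<and> (\<forall>i\<le>N k. h i \<in> C) \<and> (\<forall>i<N k. dist (h i) (h (Suc i)) < \<delta> (Suc k))"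
          by (rule connected_chain[OF F(1)[of k]]) (use F(2)[of k] C in \<open>auto simp: N_def\<close>)
        then obtain h where h: "h 0 = a" "h (N k) = b" "\<And>i. i \<le> N k \<Longrightarrow> h i \<in> C"
          "\<And>i. i < N k \<Longrightarrow> dist (h i) (h (Suc i)) < \<delta> (Suc k)" by blast
        have "(h i, h (Suc i)) \<in> R (Suc k)" if "i < N k" for i
          using d(2) h(3)[of i] h(3)[of "Suc i"] h(4)[of i] that C(2) by auto
        then show ?thesis using h C by (intro exI[of _ h]) auto
      qed
    qed
    then show "\<exists>g. path g \<and> path_image g \<subseteq> S \<inter> ball x \<epsilon> \<and> pathstart g = x \<and> pathfinish g = y"
      unfolding \<eta>_def by simp
  qed (rule d)
qed

section \<open>Paths as singular 1-chains\<close>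

lemma singular_simplex_top_of_set:
  "singular_simplex p (top_of_set S) f \<longleftrightarrow>
     continuous_on (standard_simplex p) f \<and> f ` standard_simplex p \<subseteq> S \<and> f \<in> extensional (standard_simplex p)"
  unfolding singular_simplex_def
  by (auto simp: continuous_map_in_subtopology euclidean_product_topology image_subset_iff)

lemma coordinate_continuous [continuous_intros]: "continuous_on A (\<lambda>x :: nat \<Rightarrow> real. x i)"
  by (rule continuous_on_subset[OF continuous_on_product_coordinates]) simp

lemma standard_simplex_1D:
  assumes "x \<in> standard_simplex 1"
  shows "0 \<le> x 0" "x 0 \<le> 1" "0 \<le> x 1" "x 1 \<le> 1" "x 0 = 1 - x 1" "\<And>i. i > 1 \<Longrightarrow> x i = 0"
  using assms by (auto simp: standard_simplex_def)

lemma standard_simplex_2D: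
  assumes "x \<in> standard_simplex 2"
  shows "0 \<le> x 0" "0 \<le> x 1" "0 \<le> x 2" "x 0 + x 1 + x 2 = 1"
  using assms by (auto simp: standard_simplex_def numeral_2_eq_2)

text \<open>The restriction of \<open>g\<close> to the segment from \<open>u\<close> to
  \<open>v\<close>, in barycentric coordinates. Both \<open>u > v\<close> and \<open>u = v\<close>
  are meaningful, which makes reversed and constant paths special cases.\<close>

definition seg :: "(real \<Rightarrow> 'a) \<Rightarrow> real \<Rightarrow> real \<Rightarrow> (nat \<Rightarrow> real) \<Rightarrow> 'a" where
  "seg g u v = restrict (\<lambda>x. g (u * x 0 + v * x 1)) (standard_simplex 1)"

abbreviation path_chain :: "(real \<Rightarrow> 'a) \<Rightarrow> 'a chain" where
  "path_chain g \<equiv> frag_of (seg g 0 1)"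

abbreviation bdry :: "'a::topological_space set \<Rightarrow> 'a chain set" where
  "bdry S \<equiv> Collect (singular_relboundary 1 (top_of_set S) {})"

lemma seg_cong:
  assumes "\<And>t. t \<in> closed_segment u v \<Longrightarrow> g t = h t"
  shows "seg g u v = seg h u v"
  unfolding seg_def
proof (rule restrict_ext)
  fix x :: "nat \<Rightarrow> real" assume "x \<in> standard_simplex 1"
  note x = standard_simplex_1D[OF this]
  have "u * x 0 + v * x 1 \<in> closed_segment u v"
    unfolding in_segment using x by (intro exI[of _ "x 1"]) auto
  then show "g (u * x 0 + v * x 1) = h (u * x 0 + v * x 1)" by (rule assms)
qed

text \<open>The affine map from the triangle to the interval with vertex values \<open>u\<close>,
  \<open>v\<close>, \<open>w\<close>, followed by \<open>g\<close>, is a 2-simplex with this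
  boundary. The rules for constant, subdivided, reversed and joined paths all reduce to it, so no
  homotopy is constructed.\<close>

lemma seg_triangle:
  assumes g: "path g" "path_image g \<subseteq> S" and uvw: "u \<in> {0..1}" "v \<in> {0..1}" "w \<in> {0..1}"
  shows "frag_of (seg g v w) - frag_of (seg g u w) + frag_of (seg g u v) \<in> bdry S"
proof -
  define f where "f = restrict (\<lambda>x. g (u * x 0 + v * x 1 + w * x 2)) (standard_simplex 2)"
  have *: "u * x 0 + v * x 1 + w * x 2 \<in> {0..1}" if "x \<in> standard_simplex 2" for x
  proof -
    note x = standard_simplex_2D[OF that]
    have "u * x 0 \<le> x 0" "v * x 1 \<le> x 1" "w * x 2 \<le> x 2"
      using x uvw by (auto intro: mult_left_le_one_le)
    then have "u * x 0 + v * x 1 + w * x 2 \<le> 1" using x by linarith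
    moreover have "0 \<le> u * x 0 + v * x 1 + w * x 2" using x uvw by simp
    ultimately show ?thesis by simp
  qed
  have "continuous_on (standard_simplex 2) (\<lambda>x. g (u * x 0 + v * x 1 + w * x 2))"
    by (rule continuous_on_compose2[OF g(1)[unfolded path_def]]) (use * in \<open>auto intro!: continuous_intros\<close>)
  then have "continuous_on (standard_simplex 2) f"
    unfolding f_def by (simp cong: continuous_on_cong)
  moreover have "f ` standard_simplex 2 \<subseteq> S"
    using g(2) * unfolding f_def path_image_def by auto
  ultimately have "singular_simplex 2 (top_of_set S) f"
    unfolding singular_simplex_top_of_set by (auto simp: f_def)
  then have "singular_chain (Suc 1) (top_of_set S) (frag_of f)"
    by (simp add: singular_chain_of numeral_2_eq_2)
  moreover have "chain_boundary (Suc 1) (frag_of f) = frag_of (seg g v w) - frag_of (seg g u w) + frag_of (seg g u v)"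
  proof -
    have mem: "simplical_face k x \<in> standard_simplex 2" if "k \<le> 2" "x \<in> standard_simplex 1" for k and x :: "nat \<Rightarrow> real"
      using simplical_face_in_standard_simplex[of 2 k x] that by simp
    have "singular_face 2 k f = restrict (\<lambda>x. g (u * simplical_face k x 0 + v * simplical_face k x 1
        + w * simplical_face k x 2)) (standard_simplex 1)" if "k \<le> 2" for k
      unfolding singular_face_def f_def using mem[OF that] by (auto intro!: restrict_ext)
    then have "singular_face 2 0 f = seg g v w" "singular_face 2 1 f = seg g u w" "singular_face 2 2 f = seg g u v"
      by (simp_all add: seg_def simplical_face_def)
    then show ?thesis by (simp add: chain_boundary_of numeral_2_eq_2)
  qed
  ultimately show ?thesis using singular_boundary by fastforce
qed

lemma add_subgroup_bdry: "add_subgroup (bdry S)"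
  by (rule add_subgroup_relboundary)

lemma seg_trivial:
  assumes "path g" "path_image g \<subseteq> S" "u \<in> {0..1}"
  shows "frag_of (seg g u u) \<in> bdry S"
  using seg_triangle[OF assms assms(3) assms(3)] by simp

lemma seg_split:
  assumes "path g" "path_image g \<subseteq> S" "u \<in> {0..1}" "v \<in> {0..1}" "w \<in> {0..1}"
  shows "frag_of (seg g u w) - (frag_of (seg g u v) + frag_of (seg g v w)) \<in> bdry S"
  using add_subgroup_minus[OF add_subgroup_bdry seg_triangle[OF assms]] by (simp add: algebra_simps)

text \<open>The library constant \<open>subpath\<close> requires a normed vector space as codomain.\<close>

definition subarc :: "real \<Rightarrow> real \<Rightarrow> (real \<Rightarrow> 'a) \<Rightarrow> real \<Rightarrow> 'a" where
  "subarc u v g = (\<lambda>t. g ((v - u) * t + u))"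

lemma subarc_mem:
  fixes u v t :: real
  assumes "u \<in> {0..1}" "v \<in> {0..1}" "t \<in> {0..1}"
  shows "(v - u) * t + u \<in> {0..1}"
proof -
  have "(v - u) * t + u = (1 - t) * u + t * v" by algebra
  moreover have "(1 - t) * u + t * v \<le> (1 - t) * 1 + t * 1"
    using assms by (intro add_mono mult_left_mono) auto
  ultimately show ?thesis using assms by simp
qed

lemma path_subarc:
  assumes "path g" "u \<in> {0..1}" "v \<in> {0..1}"
  shows "path (subarc u v g)"
  unfolding path_def subarc_def
  by (rule continuous_on_compose2[OF assms(1)[unfolded path_def]])
     (use subarc_mem[OF assms(2,3)] in \<open>auto intro!: continuous_intros\<close>)

lemma path_image_subarc:
  "u \<in> {0..1} \<Longrightarrow> v \<in> {0..1} \<Longrightarrow> path_image (subarc u v g) \<subseteq> path_image g"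
  unfolding path_image_def subarc_def using subarc_mem by blast

lemma seg_subarc: "path_chain (subarc u v g) = frag_of (seg g u v)"
proof -
  have "(v - u) * (0 * x 0 + 1 * x 1) + u = u * x 0 + v * x 1" if "x \<in> standard_simplex 1" for x
    unfolding standard_simplex_1D(5)[OF that] by algebra
  then show ?thesis unfolding seg_def subarc_def by (simp cong: restrict_cong)
qed

lemma path_chain_reverse:
  assumes "path g" "path_image g \<subseteq> S"
  shows "path_chain (reversepath g) + path_chain g \<in> bdry S"
proof -
  have "reversepath g = subarc 1 0 g" by (simp add: subarc_def reversepath_def fun_eq_iff)
  then have "path_chain (reversepath g) = frag_of (seg g 1 0)" by (simp only: seg_subarc)
  then show ?thesis
    using add_subgroup_add[OF add_subgroup_bdry add_subgroup_minus[OF add_subgroup_bdry seg_split[OF assms, of 0 1 0]]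
      seg_trivial[OF assms, of 0]] by (simp add: add.commute)
qed

lemma path_chain_join:
  assumes "path g" "path_image g \<subseteq> S" "path h" "path_image h \<subseteq> S" "pathfinish g = pathstart h"
  shows "path_chain (g +++ h) - (path_chain g + path_chain h) \<in> bdry S"
proof -
  have "seg (g +++ h) 0 (1/2) = seg g 0 1"
    unfolding seg_def using standard_simplex_1D by (auto intro!: restrict_ext simp: joinpaths_def)
  moreover have "seg (g +++ h) (1/2) 1 = seg h 0 1"
    unfolding seg_def
  proof (rule restrict_ext)
    fix x :: "nat \<Rightarrow> real" assume "x \<in> standard_simplex 1"
    note x = standard_simplex_1D[OF this]
    show "(g +++ h) (1/2 * x 0 + 1 * x 1) = h (0 * x 0 + 1 * x 1)"
    proof (cases "x 1 = 0")
      case True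
      then show ?thesis using x(5) assms(5) by (simp add: joinpaths_def pathfinish_def pathstart_def)
    next
      case False
      then have "0 < x 1" using x(3) by simp
      then have arg: "2 * (1/2 * x 0 + 1 * x 1) - 1 = x 1" "\<not> 1/2 * x 0 + 1 * x 1 \<le> 1/2"
        unfolding x(5) by (simp_all add: field_simps)
      show ?thesis unfolding joinpaths_def if_not_P[OF arg(2)] arg(1) by simp
    qed
  qed
  moreover have "path (g +++ h)" "path_image (g +++ h) \<subseteq> S"
    using assms by (auto simp: path_image_join)
  ultimately show ?thesis using seg_split[of "g +++ h" S 0 "1/2" 1] by simp
qed

definition point_simplex :: "'a \<Rightarrow> (nat \<Rightarrow> real) \<Rightarrow> 'a" where
  "point_simplex a = restrict (\<lambda>_. a) (standard_simplex 0)"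

lemma chain_boundary_path_chain:
  "chain_boundary 1 (path_chain g) = frag_of (point_simplex (pathfinish g)) - frag_of (point_simplex (pathstart g))"
proof -
  have mem: "simplical_face k x \<in> standard_simplex 1" if "k \<le> 1" "x \<in> standard_simplex 0" for k and x :: "nat \<Rightarrow> real"
    using simplical_face_in_standard_simplex[of 1 k x] that by simp
  have "singular_face 1 k (seg g 0 1) = restrict (\<lambda>x. g (simplical_face k x 1)) (standard_simplex 0)" if "k \<le> 1" for k
    unfolding singular_face_def seg_def using mem[OF that] by (auto intro!: restrict_ext)
  then have "singular_face 1 0 (seg g 0 1) = point_simplex (pathfinish g)"
    "singular_face 1 1 (seg g 0 1) = point_simplex (pathstart g)"
    by (auto intro!: restrict_ext simp: point_simplex_def simplical_face_def standard_simplex_0 pathstart_def pathfinish_def)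
  then show ?thesis by (simp add: chain_boundary_of)
qed

lemma singular_chain_path_chain:
  assumes "path g" "path_image g \<subseteq> S"
  shows "singular_chain 1 (top_of_set S) (path_chain g)"
proof -
  have *: "x 1 \<in> {0..1}" if "x \<in> standard_simplex 1" for x :: "nat \<Rightarrow> real"
    using standard_simplex_1D[OF that] by simp
  have "continuous_on (standard_simplex 1) (\<lambda>x. g (0 * x 0 + 1 * x 1))"
    by (rule continuous_on_compose2[OF assms(1)[unfolded path_def]]) (use * in \<open>auto intro!: continuous_intros\<close>)
  then have "continuous_on (standard_simplex 1) (seg g 0 1)"
    unfolding seg_def by (simp cong: continuous_on_cong)
  then have "singular_simplex 1 (top_of_set S) (seg g 0 1)"
    unfolding singular_simplex_top_of_set using * assms(2) by (auto simp: seg_def path_image_def)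
  then show ?thesis by (simp add: singular_chain_of)
qed

lemma singular_1_simplex_eq_seg:
  assumes "singular_simplex 1 (top_of_set S) f"
  obtains g where "path g" "path_image g \<subseteq> S" "f = seg g 0 1"
proof -
  define e where "e t = (\<lambda>i::nat. if i = 0 then 1 - t else if i = 1 then t else 0 :: real)" for t
  have e: "e t \<in> standard_simplex 1" if "t \<in> {0..1}" for t
    using that unfolding e_def standard_simplex_def by auto
  have ce: "continuous_on {0..1} e"
  proof (rule continuous_on_coordinatewise_then_product)
    show "continuous_on {0..1} (\<lambda>t. e t i)" for i
      by (cases "i = 0"; cases "i = 1") (auto simp: e_def intro!: continuous_intros)
  qed
  note f = assms[unfolded singular_simplex_top_of_set]
  define g where "g t = f (e t)" for t
  show ?thesis
  proof
    show "path g" unfolding path_def g_def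
      by (rule continuous_on_compose2[OF conjunct1[OF f] ce]) (use e in auto)
    show "path_image g \<subseteq> S" using f e unfolding path_image_def g_def by auto
    have "e (x 1) = x" if "x \<in> standard_simplex 1" for x
      using standard_simplex_1D[OF that] unfolding e_def by auto
    then show "f = seg g 0 1"
      using f unfolding seg_def g_def by (auto intro!: extensionalityI[of f "standard_simplex 1"])
  qed
qed

lemma path_chain_subdivision:
  assumes g: "path g" "path_image g \<subseteq> S" and n: "0 < n" and k: "k \<le> n"
  shows "frag_of (seg g 0 (real k / real n)) - (\<Sum>i<k. path_chain (subarc (real i / real n) (real (Suc i) / real n) g)) \<in> bdry S"
  using k
proof (induction k)
  case 0
  then show ?case using seg_trivial[OF g, of 0] by simp
next
  case (Suc k)
  have "frag_of (seg g 0 (real (Suc k) / real n)) -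
     (frag_of (seg g 0 (real k / real n)) + frag_of (seg g (real k / real n) (real (Suc k) / real n))) \<in> bdry S"
    by (rule seg_split[OF g]) (use Suc.prems n in auto)
  from add_subgroup_add[OF add_subgroup_bdry this Suc.IH] Suc.prems
  show ?case by (simp add: seg_subarc algebra_simps)
qed

section \<open>Finite generation when small loops bound\<close>

lemma lspan_reindex:
  assumes "finite I"
  shows "\<exists>(n::nat) x'. lspan {..<n} x' = lspan I x"
proof -
  obtain e where e: "bij_betw e {0..<card I} I" using ex_bij_betw_nat_finite[OF assms] by blast
  have "lspan {..<card I} (x \<circ> e) = lspan I x"
  proof (intro equalityI subsetI)
    fix v assume "v \<in> lspan {..<card I} (x \<circ> e)"
    then obtain c where c: "v = comb {..<card I} c (x \<circ> e)" by (rule lspanE)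
    have "comb I (c \<circ> inv_into {0..<card I} e) x = (\<Sum>i\<in>{0..<card I}. frag_cmul ((c \<circ> inv_into {0..<card I} e) (e i)) (x (e i)))"
      unfolding comb_def by (rule sum.reindex_bij_betw[OF e, symmetric])
    also have "\<dots> = v" unfolding c comb_def
      by (rule sum.cong) (use e in \<open>auto simp: bij_betw_def inv_into_f_f\<close>)
    finally show "v \<in> lspan I x" using comb_in_lspan by metis
  next
    fix v assume "v \<in> lspan I x"
    then obtain c where c: "v = comb I c x" by (rule lspanE)
    have "v = comb {..<card I} (c \<circ> e) (x \<circ> e)"
      unfolding c comb_def using sum.reindex_bij_betw[OF e, of "\<lambda>i. frag_cmul (c i) (x i)"]
      by (simp add: atLeast0LessThan)
    then show "v \<in> lspan {..<card I} (x \<circ> e)" using comb_in_lspan by metis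
  qed
  then show ?thesis by blast
qed

lemma generator_in_lspan:
  assumes "finite I" "i \<in> I" shows "x i \<in> lspan I x"
  unfolding lspan_remove[OF assms]
  using add_subgroup_0[OF add_subgroup_lspan, of "I - {i}" x]
  by (intro CollectI exI[of _ 1] exI[of _ 0]) simp

text \<open>A homological form of semilocal simple connectedness: the loop is confined to the ball
  and may be based anywhere in it, but the 2-chain that it bounds may use all of
  \<open>S\<close>.\<close>

definition loops_null_near :: "'a::metric_space set \<Rightarrow> real \<Rightarrow> 'a \<Rightarrow> bool" where
  "loops_null_near S \<epsilon> x \<longleftrightarrow> (\<forall>g. path g \<and> path_image g \<subseteq> S \<inter> ball x \<epsilon> \<and> pathfinish g = pathstart g
      \<longrightarrow> path_chain g \<in> bdry S)"

text \<open>The loop running along \<open>a\<close> and \<open>s\<close>, then back along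
  \<open>b\<close> and \<open>c\<close>, lies in the ball and therefore bounds. In the application
  \<open>c\<close> is a standard arc between net points, while \<open>a\<close> and \<open>b\<close>
  lead from the net to the end points of \<open>s\<close>.\<close>

lemma small_quadrilateral:
  fixes S :: "'a::metric_space set"
  assumes null: "loops_null_near S \<epsilon> p"
    and a: "path a" "path_image a \<subseteq> S \<inter> ball p \<epsilon>" "pathstart a = p"
    and s: "path s" "path_image s \<subseteq> S \<inter> ball p \<epsilon>" "pathstart s = pathfinish a"
    and b: "path b" "path_image b \<subseteq> S \<inter> ball p \<epsilon>" "pathfinish b = pathfinish s"
    and c: "path c" "path_image c \<subseteq> S \<inter> ball p \<epsilon>" "pathstart c = p" "pathfinish c = pathstart b"
  shows "path_chain s - (path_chain b - path_chain a) - path_chain c \<in> bdry S"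
proof -
  note B = add_subgroup_bdry[of S]
  let ?r = "reversepath b +++ reversepath c"
  let ?l = "a +++ (s +++ ?r)"
  have S: "path_image a \<subseteq> S" "path_image s \<subseteq> S" "path_image b \<subseteq> S" "path_image c \<subseteq> S"
    using a s b c by auto
  have r: "path ?r" "path_image ?r \<subseteq> S \<inter> ball p \<epsilon>" "pathstart ?r = pathfinish s" "pathfinish ?r = p"
    using b c by (auto simp: path_image_join)
  have sr: "path (s +++ ?r)" "path_image (s +++ ?r) \<subseteq> S \<inter> ball p \<epsilon>"
    "pathstart (s +++ ?r) = pathfinish a" "pathfinish (s +++ ?r) = p"
    using s r by (auto simp: path_image_join)
  have "path ?l" "path_image ?l \<subseteq> S \<inter> ball p \<epsilon>" "pathfinish ?l = pathstart ?l"
    using a sr by (auto simp: path_image_join)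
  then have 1: "path_chain ?l \<in> bdry S" using null unfolding loops_null_near_def by blast
  have 2: "path_chain ?l - (path_chain a + path_chain (s +++ ?r)) \<in> bdry S"
    using a sr S by (intro path_chain_join) auto
  have 3: "path_chain (s +++ ?r) - (path_chain s + path_chain ?r) \<in> bdry S"
    using s r S by (intro path_chain_join) auto
  have 4: "path_chain ?r - (path_chain (reversepath b) + path_chain (reversepath c)) \<in> bdry S"
    using b c S by (intro path_chain_join) auto
  have 5: "path_chain (reversepath b) + path_chain b \<in> bdry S"
    using b S by (intro path_chain_reverse) auto
  have 6: "path_chain (reversepath c) + path_chain c \<in> bdry S"
    using c S by (intro path_chain_reverse) auto
  have "path_chain ?l - (path_chain ?l - (path_chain a + path_chain (s +++ ?r)))
     - (path_chain (s +++ ?r) - (path_chain s + path_chain ?r))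
     - (path_chain ?r - (path_chain (reversepath b) + path_chain (reversepath c)))
     - (path_chain (reversepath b) + path_chain b) - (path_chain (reversepath c) + path_chain c) \<in> bdry S"
    (is "?z \<in> _")
    by (intro add_subgroup_diff[OF B] 1 2 3 4 5 6)
  also have "?z = path_chain s - (path_chain b - path_chain a) - path_chain c + 0"
    by (simp add: algebra_simps)
  finally show ?thesis by simp
qed

lemma cycles_finitely_generated:
  fixes S :: "'a::metric_space set"
  assumes S: "compact S" "locally connected S" and e: "0 < \<epsilon>"
    and null: "\<And>x. x \<in> S \<Longrightarrow> loops_null_near S \<epsilon> x"
  shows "\<exists>(n::nat) x. \<forall>z. singular_relcycle 1 (top_of_set S) {} z \<longrightarrow> (\<exists>v\<in>lspan {..<n} x. v - z \<in> bdry S)"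
proof -
  define \<eta> where "\<eta> = \<epsilon> / 2"
  have eta: "0 < \<eta>" using e unfolding \<eta>_def by simp
  define arc where "arc x y g \<longleftrightarrow> path g \<and> path_image g \<subseteq> S \<inter> ball x \<eta> \<and> pathstart g = x \<and> pathfinish g = y" for x y g
  obtain \<delta>0 where d0: "0 < \<delta>0" "\<forall>x\<in>S. \<forall>y\<in>S. dist x y < \<delta>0 \<longrightarrow> (\<exists>g. arc x y g)"
    using compact_locally_connected_uniformly_locally_path_connected[OF S eta]
    unfolding arc_def by (elim exE conjE)
  \<comment> \<open>Net points belonging to the two ends of a piece are less than
    \<open>3 * \<delta>\<close> apart. This has to be at most \<open>\<delta>0\<close> for a
    standard arc to exist, and at most \<open>\<eta>\<close> for the ball of radius
    \<open>\<eta>\<close> about one net point to fit into the ball of radius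
    \<open>\<epsilon> = 2 * \<eta>\<close> about the other.\<close>
  define \<delta> where "\<delta> = min \<delta>0 \<eta> / 3"
  have d: "0 < \<delta>" "3 * \<delta> \<le> \<delta>0" "3 * \<delta> \<le> \<eta>" using d0(1) eta unfolding \<delta>_def by auto
  obtain F where F: "finite F" "F \<subseteq> S" "S \<subseteq> (\<Union>p\<in>F. ball p \<delta>)"
    using compactE_image[OF S(1), of S "\<lambda>p. ball p \<delta>"] d(1) by (metis centre_in_ball open_ball UN_I subsetI)
  have "\<forall>x. \<exists>p. x \<in> S \<longrightarrow> p \<in> F \<and> dist p x < \<delta>" using F(3) by (auto simp: subset_iff)
  then obtain \<nu> where nu: "\<And>x. x \<in> S \<Longrightarrow> \<nu> x \<in> F" "\<And>x. x \<in> S \<Longrightarrow> dist (\<nu> x) x < \<delta>" by metis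
  define \<gamma> where "\<gamma> x y = (SOME g. arc x y g)" for x y
  have gam: "arc x y (\<gamma> x y)" if "x \<in> S" "y \<in> S" "dist x y < \<delta>0" for x y
    unfolding \<gamma>_def by (rule someI_ex[OF d0(2)[rule_format, OF that]])
  define \<beta> where "\<beta> x = \<gamma> (\<nu> x) x" for x
  define \<Gamma> where "\<Gamma> = (\<lambda>(p, q). path_chain (\<gamma> p q))"
  let ?L = "lspan (F \<times> F) \<Gamma>"
  \<comment> \<open>Membership in \<open>W\<close> means being, modulo boundaries, a combination of
    the finitely many standard arcs.\<close>
  define W where "W = {a + b | a b. a \<in> ?L \<and> b \<in> bdry S}"
  note L = add_subgroup_lspan[of "F \<times> F" \<Gamma>]
  note B = add_subgroup_bdry[of S]
  have W: "add_subgroup W"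
    unfolding add_subgroup_def
  proof (intro conjI ballI)
    show "0 \<in> W" unfolding W_def using add_subgroup_0[OF L] add_subgroup_0[OF B]
      by (intro CollectI exI[of _ 0]) simp
    fix a b assume "a \<in> W" "b \<in> W"
    then obtain a1 a2 b1 b2 where *: "a = a1 + a2" "b = b1 + b2" "a1 \<in> ?L" "b1 \<in> ?L" "a2 \<in> bdry S" "b2 \<in> bdry S"
      unfolding W_def by blast
    have "a - b = (a1 - b1) + (a2 - b2)" unfolding * by simp
    then show "a - b \<in> W" unfolding W_def using add_subgroup_diff[OF L *(3,4)] add_subgroup_diff[OF B *(5,6)] by blast
  qed
  have LW: "a \<in> W" if "a \<in> ?L" for a
    unfolding W_def using that add_subgroup_0[OF B] by (intro CollectI exI[of _ a] exI[of _ 0]) simp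
  have BW: "b \<in> W" if "b \<in> bdry S" for b
    unfolding W_def using that add_subgroup_0[OF L] by (intro CollectI exI[of _ 0] exI[of _ b]) simp
  have piece: "path_chain s - (path_chain (\<beta> (pathfinish s)) - path_chain (\<beta> (pathstart s))) \<in> W"
    if s: "path s" "path_image s \<subseteq> S \<inter> ball (pathstart s) \<delta>" for s
  proof -
    define a where "a = pathstart s"
    define b where "b = pathfinish s"
    have ab: "a \<in> S" "b \<in> S" "dist a b < \<delta>"
      using s pathstart_in_path_image[of s] pathfinish_in_path_image[of s] unfolding a_def b_def by auto
    define p where "p = \<nu> a"
    define q where "q = \<nu> b"
    have pq: "p \<in> F" "q \<in> F" "p \<in> S" "q \<in> S" "dist p a < \<delta>" "dist q b < \<delta>"
      using nu ab F unfolding p_def q_def by auto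
    have dpq: "dist p q < 3 * \<delta>"
      using pq ab dist_triangle[of p q a] dist_triangle[of a q b] by (simp add: dist_commute)
    have 1: "arc p a (\<beta> a)" "arc q b (\<beta> b)" "arc p q (\<gamma> p q)"
      using gam pq ab d d0 dpq unfolding \<beta>_def p_def q_def by auto
    have "ball a \<delta> \<subseteq> ball p \<epsilon>"
    proof
      fix z assume "z \<in> ball a \<delta>"
      then show "z \<in> ball p \<epsilon>" using dist_triangle[of p z a] pq(5) d e unfolding \<eta>_def by simp
    qed
    moreover have "ball q \<eta> \<subseteq> ball p \<epsilon>"
    proof
      fix z assume "z \<in> ball q \<eta>"
      then show "z \<in> ball p \<epsilon>" using dist_triangle[of p z q] dpq d(3) unfolding \<eta>_def by simp
    qed
    moreover have "ball p \<eta> \<subseteq> ball p \<epsilon>" using e unfolding \<eta>_def by auto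
    ultimately have "path_chain s - (path_chain (\<beta> b) - path_chain (\<beta> a)) - path_chain (\<gamma> p q) \<in> bdry S"
      using 1 s pq null unfolding arc_def
      by (intro small_quadrilateral[of S \<epsilon> p]) (auto simp: a_def[symmetric] b_def[symmetric])
    from BW[OF this] have "path_chain s - (path_chain (\<beta> b) - path_chain (\<beta> a)) - path_chain (\<gamma> p q) \<in> W" .
    moreover have "\<Gamma> (p, q) \<in> W" using pq F by (intro LW generator_in_lspan) auto
    then have "path_chain (\<gamma> p q) \<in> W" unfolding \<Gamma>_def by simp
    ultimately show ?thesis using add_subgroup_add[OF W] unfolding a_def b_def by fastforce
  qed
  have whole: "path_chain g - (path_chain (\<beta> (pathfinish g)) - path_chain (\<beta> (pathstart g))) \<in> W"
    if g: "path g" "path_image g \<subseteq> S" for g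
  proof -
    have "uniformly_continuous_on {0..1} g"
      using g(1) unfolding path_def by (intro compact_uniformly_continuous) auto
    then obtain \<rho> where rho: "0 < \<rho>" "\<And>s t. s \<in> {0..1} \<Longrightarrow> t \<in> {0..1} \<Longrightarrow> dist s t < \<rho> \<Longrightarrow> dist (g s) (g t) < \<delta>"
      unfolding uniformly_continuous_on_def using d(1) by metis
    obtain n where n: "1 / real (Suc n) < \<rho>" using nat_approx_posE[OF rho(1)] by blast
    define N where "N = Suc n"
    define u where "u i = real i / real N" for i
    let ?s = "\<lambda>i. subarc (u i) (u (Suc i)) g"
    have ui: "u i \<in> {0..1}" if "i \<le> N" for i using that unfolding u_def N_def by auto
    have ends: "pathstart (?s i) = g (u i)" "pathfinish (?s i) = g (u (Suc i))" for i
      unfolding subarc_def pathstart_def pathfinish_def by auto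
    have "path_chain (?s i) - (path_chain (\<beta> (g (u (Suc i)))) - path_chain (\<beta> (g (u i)))) \<in> W" if i: "i < N" for i
    proof -
      have ii: "u i \<in> {0..1}" "u (Suc i) \<in> {0..1}" using ui i by auto
      have "path_image (?s i) \<subseteq> ball (g (u i)) \<delta>"
      proof
        fix z assume "z \<in> path_image (?s i)"
        then obtain t where t: "t \<in> {0..1}" "z = g ((u (Suc i) - u i) * t + u i)"
          unfolding path_image_def subarc_def by auto
        have "u (Suc i) - u i = 1 / real N" unfolding u_def by (simp add: add_divide_distrib)
        then have "\<bar>(u (Suc i) - u i) * t\<bar> \<le> 1 / real N" using t(1) by (simp add: abs_mult divide_right_mono)
        then have "dist (u i) ((u (Suc i) - u i) * t + u i) < \<rho>"
          using n unfolding N_def dist_real_def by simp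
        then show "z \<in> ball (g (u i)) \<delta>" using rho(2) subarc_mem[OF ii t(1)] ii t(2) by simp
      qed
      then show ?thesis using piece[of "?s i"] path_subarc[OF g(1) ii] path_image_subarc[OF ii, of g] g(2)
        unfolding ends by blast
    qed
    then have "(\<Sum>i<N. path_chain (?s i) - (path_chain (\<beta> (g (u (Suc i)))) - path_chain (\<beta> (g (u i))))) \<in> W"
      by (intro add_subgroup_sum[OF W]) auto
    moreover have "(\<Sum>i<N. path_chain (\<beta> (g (u (Suc i)))) - path_chain (\<beta> (g (u i))))
        = path_chain (\<beta> (pathfinish g)) - path_chain (\<beta> (pathstart g))"
    proof -
      have "u N = 1" "u 0 = 0" unfolding u_def N_def by simp_all
      then show ?thesis
        using sum_lessThan_telescope[of "\<lambda>i. path_chain (\<beta> (g (u i)))" N]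
        by (simp add: pathfinish_def pathstart_def)
    qed
    ultimately have 1: "(\<Sum>i<N. path_chain (?s i)) - (path_chain (\<beta> (pathfinish g)) - path_chain (\<beta> (pathstart g))) \<in> W"
      by (simp add: sum_subtractf)
    have 2: "path_chain g - (\<Sum>i<N. path_chain (?s i)) \<in> W"
      using path_chain_subdivision[OF g, of N N] by (intro BW) (simp add: N_def u_def)
    from add_subgroup_add[OF W 1 2] show ?thesis by (simp add: algebra_simps)
  qed
  \<comment> \<open>\<open>T\<close> is the linear extension of the end point correction to
    0-chains; evaluating a 0-simplex at the only vertex of the standard simplex recovers its point.
    As the correction of a chain factors through its boundary, it vanishes on cycles.\<close>
  define T where "T = frag_extend (\<lambda>q :: (nat \<Rightarrow> real) \<Rightarrow> 'a. path_chain (\<beta> (q (\<lambda>j. if j = 0 then 1 else 0))))"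
  have T: "T (chain_boundary 1 (path_chain g)) = path_chain (\<beta> (pathfinish g)) - path_chain (\<beta> (pathstart g))" for g
    unfolding T_def chain_boundary_path_chain frag_extend_diff
    by (simp add: point_simplex_def standard_simplex_0)
  have chain: "c - T (chain_boundary 1 c) \<in> W" if "singular_chain 1 (top_of_set S) c" for c
    using that[unfolded singular_chain_def]
  proof (induction c rule: frag_induction)
    case zero
    then show ?case using add_subgroup_0[OF W] by (simp add: T_def)
  next
    case (one f)
    then obtain g where "path g" "path_image g \<subseteq> S" "f = seg g 0 1"
      using singular_1_simplex_eq_seg by blast
    then show ?case using whole T by simp
  next
    case (diff a b)
    from add_subgroup_diff[OF W diff] show ?case
      by (simp add: chain_boundary_diff T_def frag_extend_diff algebra_simps)
  qed
  obtain n :: nat and x where x: "lspan {..<n} x = ?L" using lspan_reindex[of "F \<times> F" \<Gamma>] F(1) by auto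
  have "\<exists>v\<in>lspan {..<n} x. v - z \<in> bdry S" if z: "singular_relcycle 1 (top_of_set S) {} z" for z
  proof -
    have "chain_boundary 1 z = 0" "singular_chain 1 (top_of_set S) z" using z by (auto simp: singular_cycle)
    then have "z \<in> W" using chain[of z] by (simp add: T_def)
    then obtain v b where vb: "z = v + b" "v \<in> ?L" "b \<in> bdry S" unfolding W_def by blast
    have "v - z = - b" unfolding vb by simp
    then show ?thesis using vb add_subgroup_minus[OF B vb(3)] x by metis
  qed
  then show ?thesis by blast
qed

section \<open>Infinite concatenations of loops\<close>

text \<open>Centres of ever smaller balls with essential loops accumulate at some \<open>x\<close>,
  and these loops lie near \<open>x\<close>. A short arc from \<open>x\<close> to the start of such
  a loop, run forth and back, moves the base point to \<open>x\<close> without changing the homology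
  class.\<close>

lemma essential_loops_at_point:
  fixes S :: "'a::metric_space set"
  assumes S: "compact S" "locally connected S"
    and ess: "\<And>\<epsilon>. 0 < \<epsilon> \<Longrightarrow> \<exists>x\<in>S. \<not> loops_null_near S \<epsilon> x"
  shows "\<exists>x\<in>S. \<forall>\<epsilon>>0. \<exists>l. path l \<and> path_image l \<subseteq> S \<inter> ball x \<epsilon> \<and> pathstart l = x \<and> pathfinish l = x
           \<and> path_chain l \<notin> bdry S"
proof -
  have "\<forall>n. \<exists>x\<in>S. \<not> loops_null_near S (1 / real (Suc n)) x" using ess by simp
  then obtain y where y: "\<And>n. y n \<in> S" "\<And>n. \<not> loops_null_near S (1 / real (Suc n)) (y n)" by metis
  obtain x r where x: "x \<in> S" and r: "strict_mono r" "(y \<circ> r) \<longlonglongrightarrow> x"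
    using S(1)[unfolded compact_def, rule_format, of y] y(1) by blast
  have free: "\<exists>g. path g \<and> path_image g \<subseteq> S \<inter> ball x \<epsilon> \<and> pathfinish g = pathstart g \<and> path_chain g \<notin> bdry S"
    if e: "0 < \<epsilon>" for \<epsilon>
  proof -
    have "\<forall>\<^sub>F n in sequentially. dist ((y \<circ> r) n) x < \<epsilon> / 2"
      by (rule tendstoD[OF r(2)]) (use e in simp)
    moreover have "\<forall>\<^sub>F n in sequentially. 1 / real (Suc n) < \<epsilon> / 2"
      using LIMSEQ_inverse_real_of_nat e by (intro order_tendstoD(2)) (auto simp: inverse_eq_divide)
    ultimately have "\<forall>\<^sub>F n in sequentially. dist ((y \<circ> r) n) x < \<epsilon> / 2 \<and> 1 / real (Suc n) < \<epsilon> / 2"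
      by (rule eventually_conj)
    then obtain n where n: "dist (y (r n)) x < \<epsilon> / 2" "1 / real (Suc n) < \<epsilon> / 2"
      by (auto simp: eventually_sequentially)
    have "1 / real (Suc (r n)) \<le> 1 / real (Suc n)"
      using seq_suble[OF r(1), of n] by (intro divide_left_mono) auto
    then have rn: "1 / real (Suc (r n)) < \<epsilon> / 2" using n(2) by linarith
    obtain g where g: "path g" "path_image g \<subseteq> S \<inter> ball (y (r n)) (1 / real (Suc (r n)))"
      "pathfinish g = pathstart g" "path_chain g \<notin> bdry S"
      using y(2)[of "r n"] unfolding loops_null_near_def by blast
    have "ball (y (r n)) (1 / real (Suc (r n))) \<subseteq> ball x \<epsilon>"
    proof
      fix z assume "z \<in> ball (y (r n)) (1 / real (Suc (r n)))"
      then show "z \<in> ball x \<epsilon>"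
        using dist_triangle[of x z "y (r n)"] n(1) rn by (simp add: dist_commute)
    qed
    then show ?thesis using g by blast
  qed
  have "\<exists>l. path l \<and> path_image l \<subseteq> S \<inter> ball x \<epsilon> \<and> pathstart l = x \<and> pathfinish l = x \<and> path_chain l \<notin> bdry S"
    if e: "0 < \<epsilon>" for \<epsilon>
  proof -
    obtain \<delta> where d: "0 < \<delta>" "\<forall>x\<in>S. \<forall>y\<in>S. dist x y < \<delta> \<longrightarrow>
      (\<exists>g. path g \<and> path_image g \<subseteq> S \<inter> ball x \<epsilon> \<and> pathstart g = x \<and> pathfinish g = y)"
      using compact_locally_connected_uniformly_locally_path_connected[OF S e] by blast
    obtain g where g: "path g" "path_image g \<subseteq> S \<inter> ball x (min \<delta> \<epsilon>)"
      "pathfinish g = pathstart g" "path_chain g \<notin> bdry S" using free[of "min \<delta> \<epsilon>"] d(1) e by auto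
    have "pathstart g \<in> S" "dist x (pathstart g) < \<delta>"
      using g(2) pathstart_in_path_image[of g] by auto
    then obtain b where b: "path b" "path_image b \<subseteq> S \<inter> ball x \<epsilon>" "pathstart b = x" "pathfinish b = pathstart g"
      using d(2) x by blast
    let ?l = "b +++ (g +++ reversepath b)"
    have gS: "path_image g \<subseteq> S \<inter> ball x \<epsilon>" using g(2) by auto
    have gr: "path (g +++ reversepath b)" "path_image (g +++ reversepath b) \<subseteq> S \<inter> ball x \<epsilon>"
      "pathstart (g +++ reversepath b) = pathstart g" "pathfinish (g +++ reversepath b) = x"
      using g gS b by (auto simp: path_image_join)
    have "path ?l" "path_image ?l \<subseteq> S \<inter> ball x \<epsilon>" "pathstart ?l = x" "pathfinish ?l = x"
      using b gr by (auto simp: path_image_join)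
    moreover have "path_chain ?l \<notin> bdry S"
    proof
      assume 0: "path_chain ?l \<in> bdry S"
      have 1: "path_chain ?l - (path_chain b + path_chain (g +++ reversepath b)) \<in> bdry S"
        using b gr by (intro path_chain_join) auto
      have 2: "path_chain (g +++ reversepath b) - (path_chain g + path_chain (reversepath b)) \<in> bdry S"
        using b g gS by (intro path_chain_join) auto
      have 3: "path_chain (reversepath b) + path_chain b \<in> bdry S"
        using b by (intro path_chain_reverse) auto
      note B = add_subgroup_bdry[of S]
      have "path_chain ?l - (path_chain ?l - (path_chain b + path_chain (g +++ reversepath b)))
         - (path_chain (g +++ reversepath b) - (path_chain g + path_chain (reversepath b)))
         - (path_chain (reversepath b) + path_chain b) \<in> bdry S" (is "?z \<in> _")
        by (intro add_subgroup_diff[OF B] 0 1 2 3)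
      also have "?z = path_chain g + 0"  by (simp add: algebra_simps)
      finally show False using g(4) by simp
    qed
    ultimately show ?thesis by blast
  qed
  then show ?thesis using x by blast
qed

text \<open>For \<open>0 < t \<le> 1\<close> the index of the half-open interval from
  \<open>(1/2) ^ Suc n\<close>, excluded, to \<open>(1/2) ^ n\<close>, included, that contains
  \<open>t\<close>.\<close>

definition dyadic_scale :: "real \<Rightarrow> nat" where
  "dyadic_scale t = (LEAST n. (1/2) ^ Suc n < t)"

lemma dyadic_scaleI: "(1/2) ^ Suc n < t \<Longrightarrow> t \<le> (1/2) ^ n \<Longrightarrow> dyadic_scale t = n"
  unfolding dyadic_scale_def
proof (rule Least_equality)
  fix m assume t: "t \<le> (1/2) ^ n" and m: "(1/2) ^ Suc m < t"
  show "n \<le> m"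
  proof (rule ccontr)
    assume "\<not> n \<le> m"
    then have "(1/2 :: real) ^ n \<le> (1/2) ^ Suc m" by (intro power_decreasing) auto
    then show False using t m by linarith
  qed
qed

lemma dyadic_scale_bounds:
  assumes "0 < t" "t \<le> 1"
  shows "(1/2) ^ Suc (dyadic_scale t) < t" "t \<le> (1/2) ^ dyadic_scale t"
proof -
  obtain n where "(1/2) ^ n < t" using real_arch_pow_inv[OF assms(1), of "1/2"] by auto
  moreover have "(1/2 :: real) ^ Suc n \<le> (1/2) ^ n" by simp
  ultimately have ex: "\<exists>n. (1/2) ^ Suc n < t" by (meson le_less_trans)
  show "(1/2) ^ Suc (dyadic_scale t) < t" unfolding dyadic_scale_def by (rule LeastI_ex[OF ex])
  show "t \<le> (1/2) ^ dyadic_scale t"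
  proof (cases "dyadic_scale t")
    case 0
    then show ?thesis using assms by simp
  next
    case (Suc m)
    then have "\<not> (1/2) ^ Suc m < t" using not_less_Least[of m "\<lambda>n. (1/2) ^ Suc n < t"] unfolding dyadic_scale_def by simp
    then show ?thesis unfolding Suc by simp
  qed
qed

text \<open>The loop \<open>l n\<close> is run on the interval from \<open>(1/2) ^ Suc n\<close> to \<open>(1/2) ^ n\<close>, so the loops
  accumulate at the parameter \<open>0\<close>.\<close>

definition infinite_join :: "'a \<Rightarrow> (nat \<Rightarrow> real \<Rightarrow> 'a) \<Rightarrow> (nat \<Rightarrow> bool) \<Rightarrow> real \<Rightarrow> 'a" where
  "infinite_join x l \<alpha> t =
     (if 0 < t \<and> \<alpha> (dyadic_scale t) then l (dyadic_scale t) (2 ^ Suc (dyadic_scale t) * t - 1) else x)"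

locale shrinking_loops =
  fixes S :: "'a::metric_space set" and x :: 'a and l :: "nat \<Rightarrow> real \<Rightarrow> 'a"
  assumes xS: "x \<in> S"
    and path_l: "\<And>n. path (l n)"
    and image_l: "\<And>n. path_image (l n) \<subseteq> S \<inter> ball x (1 / real (Suc n))"
    and start_l: "\<And>n. pathstart (l n) = x"
    and finish_l: "\<And>n. pathfinish (l n) = x"
begin

abbreviation "L \<equiv> infinite_join x l"

lemma l_ends: "l n 0 = x" "l n 1 = x"
  using start_l finish_l unfolding pathstart_def pathfinish_def by auto

text \<open>At the left end point the scale already is \<open>Suc n\<close>, but both formulas give
  \<open>x\<close> there because all loops are based at \<open>x\<close>. With closed intervals the
  pieces can be glued continuously.\<close>

lemma L_piece:
  assumes "t \<in> {(1/2) ^ Suc n..(1/2) ^ n}"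
  shows "L \<alpha> t = (if \<alpha> n then l n (2 ^ Suc n * t - 1) else x)"
proof (cases "t = (1/2) ^ Suc n")
  case True
  have *: "dyadic_scale t = Suc n" by (rule dyadic_scaleI) (auto simp: True)
  have **: "2 ^ Suc (Suc n) * t - 1 = 1" "2 ^ Suc n * t - 1 = 0"
    unfolding True by (simp_all add: power_one_over)
  show ?thesis unfolding infinite_join_def * ** by (simp add: l_ends)
next
  case False
  then have "dyadic_scale t = n" using assms by (intro dyadic_scaleI) auto
  moreover have "0 < t" using assms by (auto intro: less_le_trans[of 0 "(1/2) ^ Suc n"])
  ultimately show ?thesis unfolding infinite_join_def by simp
qed

lemma piece_argument:
  fixes t :: real
  assumes "t \<in> {(1/2) ^ Suc n..(1/2) ^ n}"
  shows "2 ^ Suc n * t - 1 \<in> {0..1}"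
proof -
  have "2 ^ Suc n * (1/2) ^ Suc n \<le> 2 ^ Suc n * t" "2 ^ Suc n * t \<le> 2 ^ Suc n * (1/2) ^ n"
    using assms by (intro mult_left_mono; simp)+
  then show ?thesis by (simp add: power_one_over)
qed

lemma L_in:
  assumes "0 < t" "t \<le> 1"
  shows "L \<alpha> t \<in> S \<inter> ball x (1 / real (Suc (dyadic_scale t)))"
proof -
  have "t \<in> {(1/2) ^ Suc (dyadic_scale t)..(1/2) ^ dyadic_scale t}" using dyadic_scale_bounds[OF assms] by simp
  from piece_argument[OF this] have "l (dyadic_scale t) (2 ^ Suc (dyadic_scale t) * t - 1) \<in> S \<inter> ball x (1 / real (Suc (dyadic_scale t)))"
    using image_l[of "dyadic_scale t"] unfolding path_image_def by blast
  then show ?thesis unfolding infinite_join_def using xS by simp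
qed

lemma L_0: "L \<alpha> 0 = x"
  unfolding infinite_join_def by simp

lemma L_continuous_away: "continuous_on {(1/2) ^ n..1} (L \<alpha>)"
proof (induction n)
  case 0
  then show ?case by simp
next
  case (Suc n)
  have "continuous_on {(1/2) ^ Suc n..(1/2) ^ n} (\<lambda>t. if \<alpha> n then l n (2 ^ Suc n * t - 1) else x)"
  proof (cases "\<alpha> n")
    case True
    have "continuous_on {(1/2) ^ Suc n..(1/2) ^ n} (\<lambda>t. l n (2 ^ Suc n * t - 1))"
      by (rule continuous_on_compose2[OF path_l[of n, unfolded path_def]])
         (use piece_argument in \<open>auto intro!: continuous_intros\<close>)
    then show ?thesis using True by simp
  qed simp
  then have "continuous_on {(1/2) ^ Suc n..(1/2) ^ n} (L \<alpha>)"
    by (rule continuous_on_eq) (rule L_piece[symmetric])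
  then have "continuous_on ({(1/2) ^ Suc n..(1/2) ^ n} \<union> {(1/2) ^ n..1}) (L \<alpha>)"
    using Suc by (intro continuous_on_closed_Un) auto
  moreover have "{(1/2 :: real) ^ Suc n..(1/2) ^ n} \<union> {(1/2) ^ n..1} = {(1/2) ^ Suc n..1}"
    by (intro ivl_disj_un_two_touch) (auto simp: power_le_one)
  ultimately show ?case by simp
qed

lemma path_L: "path (L \<alpha>)"
  unfolding path_def continuous_on_iff
proof (intro ballI allI impI)
  fix t e :: real assume t: "t \<in> {0..1}" and e: "0 < e"
  show "\<exists>d>0. \<forall>s\<in>{0..1}. dist s t < d \<longrightarrow> dist (L \<alpha> s) (L \<alpha> t) < e"
  proof (cases "t = 0")
    case True
    obtain n where n: "1 / real (Suc n) < e" using nat_approx_posE[OF e] by blast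
    have "dist (L \<alpha> s) x < e" if s: "s \<in> {0..1}" "s < (1/2) ^ n" for s
    proof (cases "s = 0")
      case False
      then have s0: "0 < s" "s \<le> 1" using s by auto
      have "n \<le> dyadic_scale s"
      proof (rule ccontr)
        assume "\<not> n \<le> dyadic_scale s"
        then have "(1/2 :: real) ^ n \<le> (1/2) ^ Suc (dyadic_scale s)" by (intro power_decreasing) auto
        then show False using dyadic_scale_bounds(1)[OF s0] s(2) by linarith
      qed
      then have "1 / real (Suc (dyadic_scale s)) \<le> 1 / real (Suc n)" by (intro divide_left_mono) auto
      then show ?thesis using L_in[OF s0, of \<alpha>] n by (simp add: dist_commute)
    qed (use e in \<open>simp add: L_0\<close>)
    then show ?thesis unfolding True L_0 by (intro exI[of _ "(1/2) ^ n"]) (auto simp: dist_real_def)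
  next
    case False
    then have "0 < t" using t by simp
    then obtain n where n: "(1/2) ^ n < t" using real_arch_pow_inv[of t "1/2"] by auto
    obtain d where d: "0 < d" "\<And>s. s \<in> {(1/2) ^ n..1} \<Longrightarrow> dist s t < d \<Longrightarrow> dist (L \<alpha> s) (L \<alpha> t) < e"
      using L_continuous_away[of n \<alpha>] n t e unfolding continuous_on_iff by (metis atLeastAtMost_iff less_imp_le)
    show ?thesis
    proof (intro exI[of _ "min d (t - (1/2) ^ n)"] conjI ballI impI)
      fix s assume s: "s \<in> {0..1}" "dist s t < min d (t - (1/2) ^ n)"
      then show "dist (L \<alpha> s) (L \<alpha> t) < e" by (intro d(2)) (auto simp: dist_real_def)
    qed (use d n in auto)
  qed
qed

lemma path_image_L: "path_image (L \<alpha>) \<subseteq> S"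
proof -
  have "L \<alpha> t \<in> S" if "t \<in> {0..1}" for t
    using L_in[of t \<alpha>] xS that by (cases "t = 0") (auto simp: L_0)
  then show ?thesis unfolding path_image_def by auto
qed

lemma L_closed: "pathstart (L \<alpha>) = x" "pathfinish (L \<alpha>) = x"
proof -
  show "pathstart (L \<alpha>) = x" unfolding pathstart_def by (rule L_0)
  have "L \<alpha> 1 = (if \<alpha> 0 then l 0 (2 ^ Suc 0 * 1 - 1) else x)" by (rule L_piece) auto
  then show "pathfinish (L \<alpha>) = x" unfolding pathfinish_def by (simp add: l_ends)
qed

lemma L_relcycle: "singular_relcycle 1 (top_of_set S) {} (path_chain (L \<alpha>))"
proof -
  have "chain_boundary 1 (path_chain (L \<alpha>)) = 0" unfolding chain_boundary_path_chain L_closed by simp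
  then show ?thesis unfolding singular_cycle using singular_chain_path_chain[OF path_L path_image_L] by blast
qed

text \<open>Away from the open interval only its right end point has scale \<open>n\<close>, and
  there the value is \<open>x\<close> whatever the coordinates are.\<close>

lemma L_agree_off:
  assumes ab: "\<And>m. m \<noteq> n \<Longrightarrow> \<alpha> m = \<beta> m" and t: "t \<in> {0..1}" "t \<notin> {(1/2) ^ Suc n<..<(1/2) ^ n}"
  shows "L \<alpha> t = L \<beta> t"
proof (cases "0 < t \<and> dyadic_scale t = n")
  case True
  then have tn: "t = (1/2) ^ n" using dyadic_scale_bounds[of t] t by auto
  then have mem: "t \<in> {(1/2) ^ Suc n..(1/2) ^ n}" by auto
  have arg: "2 ^ Suc n * t - 1 = 1" unfolding tn by (simp add: power_one_over)
  have "L \<gamma> t = x" for \<gamma> unfolding L_piece[OF mem] arg by (simp add: l_ends)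
  then show ?thesis by simp
next
  case False
  then show ?thesis using ab[of "dyadic_scale t"] unfolding infinite_join_def by auto
qed

text \<open>Cut both loops at the ends of the \<open>n\<close>-th interval. The outer pieces
  coincide as simplices and cancel; the middle pieces are \<open>l n\<close> and a constant path,
  which bounds.\<close>

lemma L_flip:
  assumes "path_chain (L \<alpha>) - path_chain (L \<beta>) \<in> bdry S"
    and ab: "\<And>m. m \<noteq> n \<Longrightarrow> \<alpha> m = \<beta> m" and n: "\<alpha> n" "\<not> \<beta> n"
  shows "path_chain (l n) \<in> bdry S"
proof -
  define u where "u = (1/2 :: real) ^ Suc n"
  define v where "v = (1/2 :: real) ^ n"
  have uv: "u \<in> {0..1}" "v \<in> {0..1}" "0 \<in> {0..1::real}" "1 \<in> {0..1::real}" "u \<le> v" "2 ^ Suc n * u = 1" "2 ^ Suc n * v = 2"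
  proof -
    have "(1/2 :: real) ^ k \<in> {0..1}" for k by (simp add: power_le_one)
    then show "u \<in> {0..1}" "v \<in> {0..1}" unfolding u_def v_def by blast+
    show "u \<le> v" unfolding u_def v_def by simp
    show "2 ^ Suc n * u = 1" "2 ^ Suc n * v = 2" unfolding u_def v_def by (simp_all add: power_one_over)
  qed simp_all
  note B = add_subgroup_bdry[of S]
  have split: "path_chain (L \<gamma>) - (frag_of (seg (L \<gamma>) 0 u) + frag_of (seg (L \<gamma>) u v) + frag_of (seg (L \<gamma>) v 1)) \<in> bdry S" for \<gamma>
    using add_subgroup_add[OF B seg_split[OF path_L path_image_L uv(3,1,4)] seg_split[OF path_L path_image_L uv(1,2,4)], of \<gamma> \<gamma>]
    by (simp add: algebra_simps)
  have agree: "L \<alpha> t = L \<beta> t" if "t \<in> {0..u} \<union> {v..1}" for t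
  proof (rule L_agree_off[OF ab])
    show "t \<in> {0..1}" using that uv(1,2) by auto
    show "t \<notin> {(1/2) ^ Suc n<..<(1/2) ^ n}" using that uv(5) unfolding u_def[symmetric] v_def[symmetric] by auto
  qed
  have "seg (L \<alpha>) 0 u = seg (L \<beta>) 0 u" "seg (L \<alpha>) v 1 = seg (L \<beta>) v 1"
    using uv(1,2) by (intro seg_cong agree; auto simp: closed_segment_eq_real_ivl)+
  note eq = this
  have piece: "L \<gamma> (u * z 0 + v * z 1) = (if \<gamma> n then l n (0 * z 0 + 1 * z 1) else x)"
    if "z \<in> standard_simplex 1" for z \<gamma>
  proof -
    note z = standard_simplex_1D[OF that]
    have "u * z 0 + v * z 1 \<in> closed_segment u v"
      unfolding in_segment using z by (intro exI[of _ "z 1"]) auto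
    then have "u * z 0 + v * z 1 \<in> {(1/2) ^ Suc n..(1/2) ^ n}"
      using uv by (simp add: closed_segment_eq_real_ivl u_def v_def)
    moreover have "2 ^ Suc n * (u * z 0 + v * z 1) - 1 = (2 ^ Suc n * u) * z 0 + (2 ^ Suc n * v) * z 1 - 1" by (simp add: algebra_simps)
    then have "2 ^ Suc n * (u * z 0 + v * z 1) - 1 = 0 * z 0 + 1 * z 1" unfolding uv(6,7) using z(5) by simp
    ultimately show ?thesis using L_piece by metis
  qed
  have "seg (L \<alpha>) u v = seg (l n) 0 1"
    unfolding seg_def using piece n by (auto intro!: restrict_ext)
  moreover have "seg (L \<beta>) u v = seg (\<lambda>_. x) 0 0"
    unfolding seg_def using piece n by (auto intro!: restrict_ext)
  moreover have "frag_of (seg (\<lambda>_. x) 0 0) \<in> bdry S"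
    by (rule seg_trivial) (use xS in \<open>auto simp: path_def path_image_def\<close>)
  ultimately have const: "frag_of (seg (L \<beta>) u v) \<in> bdry S" and ln: "path_chain (l n) = frag_of (seg (L \<alpha>) u v)" by auto
  have "(path_chain (L \<alpha>) - path_chain (L \<beta>))
     - (path_chain (L \<alpha>) - (frag_of (seg (L \<alpha>) 0 u) + frag_of (seg (L \<alpha>) u v) + frag_of (seg (L \<alpha>) v 1)))
     + (path_chain (L \<beta>) - (frag_of (seg (L \<beta>) 0 u) + frag_of (seg (L \<beta>) u v) + frag_of (seg (L \<beta>) v 1)))
     + frag_of (seg (L \<beta>) u v) \<in> bdry S" (is "?z \<in> _")
    by (intro add_subgroup_add[OF B] add_subgroup_diff[OF B] assms(1) split const)
  also have "?z = frag_of (seg (L \<alpha>) u v)" unfolding eq by (simp add: algebra_simps)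
  finally show ?thesis unfolding ln .
qed

end

section \<open>Uncountability\<close>

lemma compact_standard_simplex: "compact (standard_simplex p)"
  using compactin_standard_simplex[of p] by (simp add: euclidean_product_topology)

lemma compact_pointwise:
  fixes K :: "'i \<Rightarrow> 'b::topological_space set"
  assumes "\<And>i. compact (K i)"
  shows "compact {f. \<forall>i. f i \<in> K i}"
proof -
  have "compactin (product_topology (\<lambda>i. euclidean) UNIV) (PiE UNIV K)"
    unfolding compactin_PiE using assms by simp
  moreover have "PiE UNIV K = {f. \<forall>i. f i \<in> K i}" by (auto simp: PiE_iff)
  ultimately show ?thesis by (simp add: euclidean_product_topology)
qed

lemma tendsto_coordinate:
  fixes w :: "'n \<Rightarrow> 'i \<Rightarrow> 'b::topological_space"
  assumes "(w \<longlongrightarrow> w') G" shows "((\<lambda>n. w n i) \<longlongrightarrow> w' i) G"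
  by (rule continuous_on_tendsto_compose[OF continuous_on_product_coordinates assms]) auto

text \<open>A product of compact spaces over an uncountable index set, such as a space of all
  functions on a simplex, need not be sequentially compact. A proper filter finer than
  \<open>sequentially\<close> replaces the convergent subsequence.\<close>

lemma compact_cluster_filter:
  fixes w :: "nat \<Rightarrow> 'b::topological_space"
  assumes K: "compact K" and w: "\<And>n. w n \<in> K"
  obtains w' G where "w' \<in> K" "G \<le> sequentially" "G \<noteq> bot" "(w \<longlongrightarrow> w') G"
proof -
  let ?F = "filtermap w sequentially"
  have "?F \<noteq> bot" by (simp add: filtermap_bot_iff)
  moreover have "eventually (\<lambda>f. f \<in> K) ?F" using w by (simp add: eventually_filtermap)
  ultimately obtain w' where w': "w' \<in> K" "inf (nhds w') ?F \<noteq> bot"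
    using K unfolding compact_filter by blast
  define G where "G = inf sequentially (filtercomap w (nhds w'))"
  have "G \<noteq> bot"
  proof
    assume "G = bot"
    then have "eventually (\<lambda>_. False) G" by simp
    then obtain P Q where P: "eventually P sequentially" and Q: "eventually Q (filtercomap w (nhds w'))"
      and PQ: "\<And>n. P n \<Longrightarrow> Q n \<Longrightarrow> False"
      unfolding G_def eventually_inf by blast
    obtain R where R: "eventually R (nhds w')" "\<And>n. R (w n) \<Longrightarrow> Q n"
      using Q unfolding eventually_filtercomap by blast
    have "eventually (\<lambda>f. \<not> R f) ?F"
      unfolding eventually_filtermap using P by (rule eventually_mono) (use PQ R in blast)
    then have "eventually (\<lambda>_. False) (inf (nhds w') ?F)"
      unfolding eventually_inf using R(1) by blast
    then show False using w'(2) by (simp add: trivial_limit_def)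
  qed
  moreover have "G \<le> sequentially" unfolding G_def by simp
  moreover have "(w \<longlongrightarrow> w') G"
    unfolding G_def filterlim_def
    by (rule order_trans[OF filtermap_mono[OF inf_le2] filtermap_filtercomap])
  ultimately show ?thesis using that w'(1) by blast
qed

text \<open>Approximants with distinct limits are eventually distinct, hence finitely many approximants map to
  their limits by a function \<open>h\<close>. Applied to the faces of 2-simplices, \<open>h\<close> transports every cancellation
  in a boundary to the limit.\<close>

lemma limit_identification:
  fixes P :: "((nat \<Rightarrow> 'i \<Rightarrow> 'b::metric_space) \<times> ('i \<Rightarrow> 'b)) set"
  assumes P: "finite P" and G: "G \<noteq> bot"
    and lim: "\<And>s b i. (s, b) \<in> P \<Longrightarrow> ((\<lambda>n. s n i) \<longlongrightarrow> b i) G"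
  shows "\<exists>n h. \<forall>(s, b)\<in>P. h (s n) = b"
proof -
  have "\<forall>\<^sub>F n in G. fst p n = fst q n \<longrightarrow> snd p = snd q" if pq: "p \<in> P" "q \<in> P" for p q
  proof (cases "snd p = snd q")
    case False
    then obtain i where i: "snd p i \<noteq> snd q i" by auto
    have "((\<lambda>n. dist (fst p n i) (fst q n i)) \<longlongrightarrow> dist (snd p i) (snd q i)) G"
      using pq by (intro tendsto_dist lim) auto
    then have "\<forall>\<^sub>F n in G. 0 < dist (fst p n i) (fst q n i)"
      by (rule order_tendstoD(1)) (use i in simp)
    then show ?thesis by (rule eventually_mono) auto
  qed simp
  then have "\<forall>\<^sub>F n in G. \<forall>p\<in>P. \<forall>q\<in>P. fst p n = fst q n \<longrightarrow> snd p = snd q"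
    using P by (simp add: eventually_ball_finite)
  from eventually_happens'[OF G this]
  obtain n where n: "\<And>p q. p \<in> P \<Longrightarrow> q \<in> P \<Longrightarrow> fst p n = fst q n \<Longrightarrow> snd p = snd q"
    by blast
  define h where "h y = snd (SOME p. p \<in> P \<and> fst p n = y)" for y
  have "h (s n) = b" if sb: "(s, b) \<in> P" for s b
  proof -
    have "\<exists>p. p \<in> P \<and> fst p n = s n" using sb by force
    from someI_ex[OF this] have "snd (SOME p. p \<in> P \<and> fst p n = s n) = snd (s, b)"
      using sb by (intro n) auto
    then show ?thesis unfolding h_def by simp
  qed
  then show ?thesis by blast
qed

text \<open>Entry \<open>k\<close> of the list is a modulus for the precision
  \<open>1 / Suc k\<close>, so appending an entry adds one constraint. The inequalities are not
  strict, hence survive pointwise limits.\<close>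

definition has_moduli :: "nat list \<Rightarrow> ((nat \<Rightarrow> real) \<Rightarrow> 'a::metric_space) \<Rightarrow> bool" where
  "has_moduli s f \<longleftrightarrow> (\<forall>k<length s. \<forall>z\<in>standard_simplex 2. \<forall>z'\<in>standard_simplex 2.
     dist z z' \<le> 1 / real (Suc (s ! k)) \<longrightarrow> dist (f z) (f z') \<le> 1 / real (Suc k))"

lemma has_moduli_append:
  "has_moduli (s @ [i]) f \<longleftrightarrow> has_moduli s f \<and>
     (\<forall>z\<in>standard_simplex 2. \<forall>z'\<in>standard_simplex 2.
        dist z z' \<le> 1 / real (Suc i) \<longrightarrow> dist (f z) (f z') \<le> 1 / real (Suc (length s)))"
  unfolding has_moduli_def by (simp add: All_less_Suc nth_append conj_commute)

lemma singular_simplex_has_modulus: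
  fixes S :: "'a::metric_space set"
  assumes "singular_simplex 2 (top_of_set S) f"
  shows "\<exists>i. \<forall>z\<in>standard_simplex 2. \<forall>z'\<in>standard_simplex 2.
      dist z z' \<le> 1 / real (Suc i) \<longrightarrow> dist (f z) (f z') \<le> 1 / real (Suc k)"
proof -
  have "uniformly_continuous_on (standard_simplex 2) f"
    using assms unfolding singular_simplex_top_of_set
    by (intro compact_uniformly_continuous compact_standard_simplex) auto
  then obtain \<rho> where rho: "0 < \<rho>" "\<forall>z\<in>standard_simplex 2. \<forall>z'\<in>standard_simplex 2.
      dist z' z < \<rho> \<longrightarrow> dist (f z') (f z) < 1 / real (Suc k)"
    unfolding uniformly_continuous_on_def by (metis zero_less_divide_1_iff of_nat_0_less_iff zero_less_Suc)
  obtain i where "1 / real (Suc i) < \<rho>" using nat_approx_posE[OF rho(1)] by blast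
  then have "dist (f z) (f z') \<le> 1 / real (Suc k)"
    if "z \<in> standard_simplex 2" "z' \<in> standard_simplex 2" "dist z z' \<le> 1 / real (Suc i)" for z z'
    using rho(2) that by (intro less_imp_le) auto
  then show ?thesis by blast
qed

lemma continuous_on_moduli:
  fixes f :: "(nat \<Rightarrow> real) \<Rightarrow> 'a::metric_space"
  assumes "\<And>k z z'. z \<in> standard_simplex 2 \<Longrightarrow> z' \<in> standard_simplex 2 \<Longrightarrow>
     dist z z' \<le> 1 / real (Suc (b k)) \<Longrightarrow> dist (f z) (f z') \<le> 1 / real (Suc k)"
  shows "continuous_on (standard_simplex 2) f"
  unfolding continuous_on_iff
proof (intro ballI allI impI)
  fix z and e :: real assume z: "z \<in> standard_simplex 2" and e: "0 < e"
  obtain k where k: "1 / real (Suc k) < e" using nat_approx_posE[OF e] by blast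
  show "\<exists>d>0. \<forall>z'\<in>standard_simplex 2. dist z' z < d \<longrightarrow> dist (f z') (f z) < e"
  proof (intro exI[of _ "1 / real (Suc (b k))"] conjI ballI impI)
    fix z' assume "z' \<in> standard_simplex 2" "dist z' z < 1 / real (Suc (b k))"
    then have "dist (f z') (f z) \<le> 1 / real (Suc k)" using z by (intro assms) auto
    then show "dist (f z') (f z) < e" using k by simp
  qed simp
qed

text \<open>Coefficients and simplices are kept apart, and the simplices may coincide: a limit of
  tuples may merge simplices and is still of this form with the same coefficients.\<close>

abbreviation chain_of_list :: "int list \<Rightarrow> (nat \<Rightarrow> (nat \<Rightarrow> real) \<Rightarrow> 'a) \<Rightarrow> 'a chain" where
  "chain_of_list e w \<equiv> (\<Sum>j<length e. frag_cmul (e ! j) (frag_of (w j)))"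

lemma chain_boundary_chain_of_list:
  "chain_boundary 2 (chain_of_list e w)
     = (\<Sum>j<length e. frag_cmul (e ! j) (\<Sum>k\<le>2. frag_cmul ((-1) ^ k) (frag_of (singular_face 2 k (w j)))))"
  by (simp add: chain_boundary_sum chain_boundary_cmul chain_boundary_of)

lemma chain_eq_chain_of_list:
  fixes d :: "'a chain"
  obtains e w where "d = chain_of_list e w" "\<And>j. j < length e \<Longrightarrow> w j \<in> Poly_Mapping.keys d"
proof -
  obtain ks where ks: "set ks = Poly_Mapping.keys d" "distinct ks"
    using finite_distinct_list[OF finite_keys[of d]] by blast
  let ?e = "map (poly_mapping.lookup d) ks"
  have "d = frag_extend frag_of d" by (simp add: frag_expansion[symmetric])
  also have "\<dots> = (\<Sum>f\<in>set ks. frag_cmul (poly_mapping.lookup d f) (frag_of f))"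
    unfolding frag_extend_def ks(1) ..
  also have "\<dots> = (\<Sum>j<length ks. frag_cmul (poly_mapping.lookup d (ks ! j)) (frag_of (ks ! j)))"
    using bij_betw_nth[OF ks(2) refl refl] by (rule sum.reindex_bij_betw[symmetric])
  also have "\<dots> = chain_of_list ?e ((!) ks)" by simp
  finally have "d = chain_of_list ?e ((!) ks)" .
  then show ?thesis by (rule that) (simp flip: ks(1))
qed

section \<open>2-chains with prescribed coefficients and moduli\<close>

context shrinking_loops
begin

text \<open>The list \<open>s\<close> is the node of the scheme in
  \<open>increasing_scheme_flip_pair\<close>. The equation is one of chains, not of classes, so that
  a limit can be taken in it.\<close>

definition witnessed :: "'a chain \<Rightarrow> int list \<Rightarrow> nat list \<Rightarrow> (nat \<Rightarrow> bool) set" where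
  "witnessed c e s = {\<alpha>. \<exists>w. (\<forall>j<length e. singular_simplex 2 (top_of_set S) (w j) \<and> has_moduli s (w j)) \<and>
      chain_boundary 2 (chain_of_list e w) = path_chain (L \<alpha>) - c}"

lemma witnessed_homologous:
  assumes "\<alpha> \<in> witnessed c e s" shows "path_chain (L \<alpha>) - c \<in> bdry S"
proof -
  obtain w where w: "\<And>j. j < length e \<Longrightarrow> singular_simplex 2 (top_of_set S) (w j)"
    "chain_boundary 2 (chain_of_list e w) = path_chain (L \<alpha>) - c"
    using assms unfolding witnessed_def by blast
  have "singular_chain 2 (top_of_set S) (chain_of_list e w)"
    by (intro singular_chain_sum singular_chain_cmul) (use w(1) in \<open>simp add: singular_chain_of\<close>)
  then show ?thesis using w(2) by (auto simp: singular_boundary numeral_2_eq_2)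
qed

lemma homologous_witnessed:
  assumes "path_chain (L \<alpha>) - c \<in> bdry S" obtains e where "\<alpha> \<in> witnessed c e []"
proof -
  obtain d where d: "singular_chain 2 (top_of_set S) d" "chain_boundary 2 d = path_chain (L \<alpha>) - c"
    using assms by (auto simp: singular_boundary numeral_2_eq_2)
  obtain e w where ew: "d = chain_of_list e w" "\<And>j. j < length e \<Longrightarrow> w j \<in> Poly_Mapping.keys d"
    using chain_eq_chain_of_list by blast
  have "\<alpha> \<in> witnessed c e []"
    unfolding witnessed_def
    using d ew by (auto simp: singular_chain_def has_moduli_def intro!: exI[of _ w])
  then show ?thesis by (rule that)
qed

lemma witnessed_mono:
  assumes "i \<le> j" shows "witnessed c e (s @ [i]) \<subseteq> witnessed c e (s @ [j])"
proof -
  have "1 / real (Suc j) \<le> 1 / real (Suc i)" using assms by (intro divide_left_mono) auto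
  then have "has_moduli (s @ [j]) f" if "has_moduli (s @ [i]) f" for f :: "(nat \<Rightarrow> real) \<Rightarrow> 'a"
    using that unfolding has_moduli_append by (meson order_trans)
  then show ?thesis unfolding witnessed_def by blast
qed

lemma witnessed_Union: "witnessed c e s = (\<Union>i. witnessed c e (s @ [i]))"
proof (intro equalityI subsetI)
  fix \<alpha> assume "\<alpha> \<in> witnessed c e s"
  then obtain w where w: "\<And>j. j < length e \<Longrightarrow> singular_simplex 2 (top_of_set S) (w j)"
    "\<And>j. j < length e \<Longrightarrow> has_moduli s (w j)"
    "chain_boundary 2 (chain_of_list e w) = path_chain (L \<alpha>) - c"
    unfolding witnessed_def by blast
  define M where "M f i \<longleftrightarrow> (\<forall>z\<in>standard_simplex 2. \<forall>z'\<in>standard_simplex 2.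
      dist z z' \<le> 1 / real (Suc i) \<longrightarrow> dist (f z) (f z') \<le> 1 / real (Suc (length s)))" for f :: "(nat \<Rightarrow> real) \<Rightarrow> 'a" and i
  have M_mono: "M f j" if "M f i" "i \<le> j" for f i j
  proof -
    have "1 / real (Suc j) \<le> 1 / real (Suc i)" using that(2) by (intro divide_left_mono) auto
    then show ?thesis using that(1) unfolding M_def by (meson order_trans)
  qed
  have "\<forall>j. \<exists>i. j < length e \<longrightarrow> M (w j) i"
    using singular_simplex_has_modulus[OF w(1)] unfolding M_def by blast
  then obtain m where m: "\<And>j. j < length e \<Longrightarrow> M (w j) (m j)" by metis
  \<comment> \<open>The sum is a common upper bound for the finitely many indices
    \<open>m j\<close>, and \<open>M\<close> is monotone in the index.\<close>
  define i where "i = (\<Sum>j<length e. m j)"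
  have "M (w j) i" if "j < length e" for j
    using M_mono[OF m[OF that]] member_le_sum[of j "{..<length e}" m] that unfolding i_def by simp
  then have "\<alpha> \<in> witnessed c e (s @ [i])"
    unfolding witnessed_def has_moduli_append using w unfolding M_def by blast
  then show "\<alpha> \<in> (\<Union>i. witnessed c e (s @ [i]))" by blast
next
  fix \<alpha> assume "\<alpha> \<in> (\<Union>i. witnessed c e (s @ [i]))"
  then show "\<alpha> \<in> witnessed c e s" unfolding witnessed_def has_moduli_append by blast
qed

text \<open>The approximating tuples of simplices cluster pointwise by compactness. The
  \<open>k\<close>-th modulus holds for all members after the \<open>k\<close>-th, hence in the
  limit, which makes the limit simplices continuous. The boundary equation of a single suitable
  approximant is then carried over to the limit by substituting 1-simplices.\<close>

lemma witnessed_closed: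
  assumes near: "\<And>n. \<exists>\<alpha>\<in>witnessed c e (map b [0..<n]). \<forall>i<n. \<alpha> i = \<beta> i" and S: "compact S"
  shows "\<beta> \<in> witnessed c e []"
proof -
  let ?D = "standard_simplex 2"
  obtain \<alpha> where al: "\<And>n. \<alpha> n \<in> witnessed c e (map b [0..<n])" "\<And>n i. i < n \<Longrightarrow> \<alpha> n i = \<beta> i"
    using near by metis
  have "\<forall>n. \<exists>w. (\<forall>j<length e. singular_simplex 2 (top_of_set S) (w j) \<and> has_moduli (map b [0..<n]) (w j)) \<and>
      chain_boundary 2 (chain_of_list e w) = path_chain (L (\<alpha> n)) - c"
    using al(1) unfolding witnessed_def by blast
  from choice[OF this] obtain v where v: "\<And>n j. j < length e \<Longrightarrow> singular_simplex 2 (top_of_set S) (v n j)"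
    "\<And>n j. j < length e \<Longrightarrow> has_moduli (map b [0..<n]) (v n j)"
    "\<And>n. chain_boundary 2 (chain_of_list e (v n)) = path_chain (L (\<alpha> n)) - c" by blast
  \<comment> \<open>Entries beyond the coefficient list get a constant default simplex, and values
    outside the standard simplex are pinned to \<open>undefined\<close>. So all tuples lie in one
    compact product, and limits are extensional again.\<close>
  define w where "w n j = (if j < length e then v n j else restrict (\<lambda>_. x) ?D)" for n j
  define T where "T z = (if z \<in> ?D then S else {undefined})" for z
  define K where "K = {w :: nat \<Rightarrow> (nat \<Rightarrow> real) \<Rightarrow> 'a. \<forall>j. w j \<in> {f. \<forall>z. f z \<in> T z}}"
  have "compact (T z)" for z unfolding T_def using S by simp
  then have K: "compact K" unfolding K_def by (intro compact_pointwise)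
  have "w n \<in> K" for n
    using v(1) xS unfolding K_def T_def w_def singular_simplex_top_of_set by (auto simp: extensional_def)
  then obtain w' G where w': "w' \<in> K" and G: "G \<le> sequentially" "G \<noteq> bot" and lim: "(w \<longlongrightarrow> w') G"
    using compact_cluster_filter[OF K] by metis
  have lim2: "((\<lambda>n. w n j z) \<longlongrightarrow> w' j z) G" for j z
    by (rule tendsto_coordinate[OF tendsto_coordinate[OF lim]])
  have seq: "eventually P G" if "eventually P sequentially" for P using filter_leD[OF G(1) that] .
  have simplex: "singular_simplex 2 (top_of_set S) (w' j)" if j: "j < length e" for j
    unfolding singular_simplex_top_of_set
  proof (intro conjI)
    show "w' j ` ?D \<subseteq> S" "w' j \<in> extensional ?D"
      using w' unfolding K_def T_def extensional_def by (auto split: if_splits)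
    show "continuous_on ?D (w' j)"
    proof (rule continuous_on_moduli[of b])
      fix k z z' assume z: "z \<in> ?D" "z' \<in> ?D" "dist z z' \<le> 1 / real (Suc (b k))"
      have "dist (w n j z) (w n j z') \<le> 1 / real (Suc k)" if "k < n" for n
        using v(2)[OF j, of n] z j that unfolding has_moduli_def w_def by simp
      then have "\<forall>\<^sub>F n in G. dist (w n j z) (w n j z') \<le> 1 / real (Suc k)"
        by (rule seq[OF eventually_mono[OF eventually_gt_at_top[of k]]])
      then show "dist (w' j z) (w' j z') \<le> 1 / real (Suc k)"
        by (intro tendsto_upperbound[OF tendsto_dist[OF lim2 lim2]] G(2))
    qed
  qed
  \<comment> \<open>All 1-simplices that can occur in the boundary equation, each paired with its
    limit; the simplices of \<open>c\<close> enter as constant sequences, which forces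
    \<open>h\<close> to fix them.\<close>
  define P where "P = (\<lambda>(j, k). (\<lambda>n. singular_face 2 k (w n j), singular_face 2 k (w' j))) ` ({..<length e} \<times> {..2::nat})
     \<union> {(\<lambda>n. seg (L (\<alpha> n)) 0 1, seg (L \<beta>) 0 1)} \<union> (\<lambda>f. (\<lambda>n. f, f)) ` Poly_Mapping.keys c"
  have limP: "((\<lambda>n. s n u) \<longlongrightarrow> f u) G" if "(s, f) \<in> P" for s f u
  proof -
    have "((\<lambda>n. singular_face 2 k (w n j) u) \<longlongrightarrow> singular_face 2 k (w' j) u) G" for k j
      unfolding singular_face_def using lim2 by (simp add: restrict_def)
    moreover have "((\<lambda>n. seg (L (\<alpha> n)) 0 1 u) \<longlongrightarrow> seg (L \<beta>) 0 1 u) G"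
    proof (rule tendsto_eventually, rule seq)
      \<comment> \<open>At a fixed parameter the value of \<open>L\<close> depends on one coordinate
        of \<open>\<alpha>\<close> only, so convergence is eventual equality.\<close>
      have "seg (L (\<alpha> n)) 0 1 u = seg (L \<beta>) 0 1 u" if "dyadic_scale (0 * u 0 + 1 * u 1) < n" for n
        using al(2)[OF that] unfolding seg_def infinite_join_def restrict_def by simp
      then show "\<forall>\<^sub>F n in sequentially. seg (L (\<alpha> n)) 0 1 u = seg (L \<beta>) 0 1 u"
        by (rule eventually_mono[OF eventually_gt_at_top[of "dyadic_scale (0 * u 0 + 1 * u 1)"]])
    qed
    ultimately show ?thesis using that unfolding P_def by auto
  qed
  have finP: "finite P" unfolding P_def by auto
  have "\<exists>n h. \<forall>(s, f)\<in>P. h (s n) = f"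
    by (rule limit_identification[OF finP G(2)]) (rule limP)
  then obtain n h where all: "\<forall>(s, f)\<in>P. h (s n) = f" by (elim exE)
  have h: "h (s n) = f" if "(s, f) \<in> P" for s f using all that by auto
  let ?h = "frag_extend (frag_of \<circ> h)"
  have h_face: "h (singular_face 2 k (w n j)) = singular_face 2 k (w' j)" if "j < length e" "k \<le> 2" for j k
    by (rule h[of "\<lambda>n. singular_face 2 k (w n j)"]) (use that in \<open>force simp: P_def\<close>)
  have h_L: "h (seg (L (\<alpha> n)) 0 1) = seg (L \<beta>) 0 1"
    by (rule h[of "\<lambda>n. seg (L (\<alpha> n)) 0 1"]) (simp add: P_def)
  have h_c: "?h c = c"
  proof -
    have "h f = f" if "f \<in> Poly_Mapping.keys c" for f
      by (rule h[of "\<lambda>_. f"]) (use that in \<open>simp add: P_def\<close>)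
    then have "?h c = frag_extend frag_of c" by (intro frag_extend_eq) auto
    then show ?thesis by (simp add: frag_expansion[symmetric])
  qed
  have "?h (chain_boundary 2 (chain_of_list e (w n))) = chain_boundary 2 (chain_of_list e w')"
    unfolding chain_boundary_chain_of_list
    by (simp add: frag_extend_sum frag_extend_cmul)
       (intro sum.cong refl arg_cong[where f = "frag_cmul _"]; simp add: h_face)
  moreover have "chain_of_list e (w n) = chain_of_list e (v n)" unfolding w_def by simp
  ultimately have "chain_boundary 2 (chain_of_list e w') = ?h (path_chain (L (\<alpha> n)) - c)"
    using v(3)[of n] by simp
  also have "\<dots> = path_chain (L \<beta>) - c" by (simp add: frag_extend_diff h_c h_L)
  finally show ?thesis unfolding witnessed_def using simplex
    by (auto simp: has_moduli_def intro!: exI[of _ w'])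
qed

text \<open>With countably many classes, the pairs of a class and a coefficient list give a
  countable cover of Cantor space. A member of positive outer measure contains some
  \<open>\<alpha>\<close> together with \<open>flip n \<alpha>\<close>; both loops are homologous to
  the same chain, so \<open>l n\<close> would bound.\<close>

lemma uncountable_homology:
  assumes S: "compact S" and ess: "\<And>n. path_chain (l n) \<notin> bdry S"
  shows "uncountable (carrier (homology_group 1 (top_of_set S)))"
proof
  assume cnt: "countable (carrier (homology_group 1 (top_of_set S)))"
  define cl where "cl \<alpha> = homologous_rel_set 1 (top_of_set S) {} (path_chain (L \<alpha>))" for \<alpha>
  have cl_eq: "cl \<alpha> = cl \<beta> \<longleftrightarrow> path_chain (L \<alpha>) - path_chain (L \<beta>) \<in> bdry S" for \<alpha> \<beta>
    unfolding cl_def homologous_rel_set_eq by (simp add: homologous_rel_def)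
  have "range cl \<subseteq> carrier (homology_group 1 (top_of_set S))"
    using carrier_relative_homology_group[of 1 "top_of_set S" "{}"] L_relcycle unfolding cl_def by auto
  then have "countable (range cl)" using cnt countable_subset by blast
  \<comment> \<open>One fixed chain for each class; it cancels when two witnessed parameters are
    compared.\<close>
  define rep where "rep q = path_chain (L (SOME \<gamma>. cl \<gamma> = q))" for q
  define A where "A = (\<lambda>(q, e). witnessed (rep q) e)"
  define C where "C = range cl \<times> (UNIV :: int list set)"
  have "countable C" unfolding C_def using \<open>countable (range cl)\<close> by simp
  moreover have "(\<Union>p\<in>C. A p []) = UNIV"
  proof -
    have "\<exists>p\<in>C. \<alpha> \<in> A p []" for \<alpha>
    proof -
      have "cl (SOME \<gamma>. cl \<gamma> = cl \<alpha>) = cl \<alpha>" by (rule someI[of _ \<alpha>]) (rule refl)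
      from this[symmetric] have "path_chain (L \<alpha>) - rep (cl \<alpha>) \<in> bdry S"
        unfolding rep_def cl_eq .
      then obtain e where "\<alpha> \<in> witnessed (rep (cl \<alpha>)) e []" by (rule homologous_witnessed)
      then show ?thesis unfolding A_def C_def by force
    qed
    then show ?thesis by blast
  qed
  ultimately obtain p where "outer_measure_of coin (A p []) > 0"
    using countable_cover_outer_pos[of C "\<lambda>p. A p []"] by blast
  moreover obtain q e where p: "p = (q, e)" by (cases p)
  ultimately have pos: "outer_measure_of coin (witnessed (rep q) e []) > 0" unfolding A_def by simp
  have "\<exists>\<alpha> n. \<alpha> \<in> witnessed (rep q) e [] \<and> flip n \<alpha> \<in> witnessed (rep q) e []"
    by (rule increasing_scheme_flip_pair[OF witnessed_Union witnessed_mono witnessed_closed[OF _ S] pos])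
  then obtain \<alpha> n where an: "\<alpha> \<in> witnessed (rep q) e []" "flip n \<alpha> \<in> witnessed (rep q) e []" by blast
  note B = add_subgroup_bdry[of S]
  have d: "path_chain (L \<alpha>) - path_chain (L (flip n \<alpha>)) \<in> bdry S"
    "path_chain (L (flip n \<alpha>)) - path_chain (L \<alpha>) \<in> bdry S"
    using add_subgroup_diff[OF B witnessed_homologous[OF an(1)] witnessed_homologous[OF an(2)]]
      add_subgroup_diff[OF B witnessed_homologous[OF an(2)] witnessed_homologous[OF an(1)]] by auto
  have "path_chain (l n) \<in> bdry S"
  proof (cases "\<alpha> n")
    case True
    show ?thesis by (rule L_flip[OF d(1)]) (use True in \<open>auto simp: flip_def\<close>)
  next
    case False
    show ?thesis by (rule L_flip[OF d(2)]) (use False in \<open>auto simp: flip_def\<close>)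
  qed
  then show False using ess by blast
qed

end

section \<open>The dichotomy and its transfer to the group of the statement\<close>

lemma homology_dichotomy:
  fixes S :: "'a::metric_space set"
  assumes S: "compact S" "locally connected S"
  shows "uncountable (carrier (homology_group 1 (top_of_set S)))
         \<or> (\<exists>(n::nat) (m::nat \<Rightarrow> nat). homology_group 1 (top_of_set S) \<cong> sum_group {..<n} (\<lambda>i. integer_mod_group (m i)))"
proof (cases "\<exists>\<epsilon>>0. \<forall>x\<in>S. loops_null_near S \<epsilon> x")
  case True
  then obtain n :: nat and y where "\<forall>z. singular_relcycle 1 (top_of_set S) {} z \<longrightarrow> (\<exists>v\<in>lspan {..<n} y. v - z \<in> bdry S)"
    using cycles_finitely_generated[OF S] by blast
  then have "\<exists>m :: nat \<Rightarrow> nat. homology_group (int 1) (top_of_set S) \<cong> sum_group {..<n} (\<lambda>i. integer_mod_group (m i))"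
    by (intro homology_group_sum_of_cyclic[of 1 "top_of_set S" n y]) blast
  then show ?thesis by (simp only: of_nat_1) blast
next
  case False
  then have "\<And>\<epsilon>. 0 < \<epsilon> \<Longrightarrow> \<exists>x\<in>S. \<not> loops_null_near S \<epsilon> x" by blast
  from essential_loops_at_point[OF S this] obtain x where x: "x \<in> S"
    "\<And>\<epsilon>. 0 < \<epsilon> \<Longrightarrow> \<exists>l. path l \<and> path_image l \<subseteq> S \<inter> ball x \<epsilon> \<and> pathstart l = x \<and> pathfinish l = x
           \<and> path_chain l \<notin> bdry S" by blast
  have "\<forall>n. \<exists>l. path l \<and> path_image l \<subseteq> S \<inter> ball x (1 / real (Suc n)) \<and> pathstart l = x \<and> pathfinish l = x
           \<and> path_chain l \<notin> bdry S"
    by (intro allI x(2)) simp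
  from choice[OF this] obtain l where l: "\<And>n. path (l n) \<and> path_image (l n) \<subseteq> S \<inter> ball x (1 / real (Suc n))
     \<and> pathstart (l n) = x \<and> pathfinish (l n) = x \<and> path_chain (l n) \<notin> bdry S" by blast
  interpret shrinking_loops S x l
    by unfold_locales (use x(1) l in blast)+
  show ?thesis using uncountable_homology[OF S(1)] l by blast
qed

text \<open>The development works with the library constants, whose defining formulas agree with
  those of the statement. They are identified from simplices upwards; absolute cycles and boundaries
  are the relative ones for the empty subspace.\<close>

lemma singular_homology_group_eq: "singular_homology_group p X = homology_group (int p) X"
proof -
  have simplex: "(Defs.standard_simplex :: nat \<Rightarrow> _) = Simplices.standard_simplex"
    by (intro ext) (simp only: Defs.standard_simplex_def Simplices.standard_simplex_def)
  have face: "(Defs.simplical_face :: nat \<Rightarrow> (nat \<Rightarrow> real) \<Rightarrow> _) = Simplices.simplical_face"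
    by (intro ext) (simp only: Defs.simplical_face_def Simplices.simplical_face_def)
  have singular: "(Defs.singular_simplex :: nat \<Rightarrow> 'a topology \<Rightarrow> _) = Simplices.singular_simplex"
    by (intro ext) (simp only: Defs.singular_simplex_def Simplices.singular_simplex_def simplex)
  have singular_face: "(Defs.singular_face :: nat \<Rightarrow> nat \<Rightarrow> ((nat \<Rightarrow> real) \<Rightarrow> 'a) \<Rightarrow> _) = Simplices.singular_face"
    by (intro ext) (simp only: Defs.singular_face_def Simplices.singular_face_def simplex face)
  have chain: "(Defs.singular_chain :: nat \<Rightarrow> 'a topology \<Rightarrow> _) = Simplices.singular_chain"
    by (intro ext) (simp only: Defs.singular_chain_def Simplices.singular_chain_def singular)
  have boundary: "(Defs.chain_boundary :: nat \<Rightarrow> 'a chain \<Rightarrow> _) = Simplices.chain_boundary"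
    by (intro ext) (simp only: Defs.chain_boundary_def Simplices.chain_boundary_def singular_face)
  have cycle: "singular_cycle p X = singular_relcycle p X {}"
    by (intro ext) (simp only: singular_cycle_def Simplices.singular_cycle chain boundary)
  have bdry: "Defs.singular_boundary p X = singular_relboundary p X {}"
    by (intro ext) (simp only: Defs.singular_boundary_def Simplices.singular_boundary chain boundary)
  show ?thesis
    unfolding singular_homology_group_def nontrivial_relative_homology_group cycle_group_def relcycle_group_def
      Defs.chain_group_def Homology_Groups.chain_group_def singular cycle bdry ..
qed

theorem theorem1p1:
  fixes S :: "'a::metric_space set"
  assumes "compact S" and "locally connected S"
  shows "uncountable (carrier (singular_homology_group 1 (subtopology euclidean S)))
         \<or> (\<exists>(n::nat) (m::nat \<Rightarrow> nat).
               singular_homology_group 1 (subtopology euclidean S)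
                 \<cong> sum_group {..<n} (\<lambda>i. integer_mod_group (m i)))"
  unfolding singular_homology_group_eq of_nat_1 by (rule homology_dichotomy[OF assms])

end
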